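(* Let $\pi:M\to B$ be a Donaldson's adiabatic fibration and $s:B\to M$ a section. The formal adiabatic limiting condition for $s$ to be an associative section is the Fueter equation. That is, at each $b\in B$ with oriented orthonormal basis $\partial/\partial t_i$ of $T_bB$, the limiting equation $$\lim_{\epsilon\to0}\chi_\epsilon\Big(ds(\tfrac{\partial}{\partial t_1}),ds(\tfrac{\partial}{\partial t_2}),ds(\tfrac{\partial}{\partial t_3})\Big)=0$$ is equivalent to $$\sum_{i=1}^3I_i\nabla_{\frac{\partial}{\partial t_i}}s=0,$$ where $\nabla_{\partial/\partial t_i}s$ denotes the vertical component of $ds(\partial/\partial t_i)$ with respect to the horizontal distribution $H$.
   Context: **Donaldson's adiabatic fibration.** $B$ is a contractible oriented 3-manifold, $\pi:M\to B$ a smooth fibre bundle with fibres $M_b$ diffeomorphic to the K3 manifold, $H\subset TM$ an Ehresmann connection. $H$ induces a bigrading $\Omega^{p,q}$ of forms ($p$ horizontal, $q$ vertical degree) and $d=d_f+d_H+F_H$ with parts of bidegree $(0,1),(1,0),(2,-1)$. The data are $\underline\omega\in\Omega^{1,2}$, $\underline\lambda\in\Omega^{3,0}$, $\underline\Theta\in\Omega^{2,2}$, $\underline\mu\in\Omega^{0,4}$ which at each point, in suitable coframes $dt_i$ (of $T_b^*B$) and $dx_j$ (vertical), have the form $\underline\omega=\sum_i\omega_i dt_i$, $\underline\lambda=-dt_1dt_2dt_3$, $\underline\Theta=-\sum_{cyc}\omega_i dt_jdt_k$, $\underline\mu=\frac12\omega_1^2$ with $\omega_1=dx_1dx_2+dx_3dx_4$,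 $\omega_2=dx_1dx_3-dx_2dx_4$, $\omega_3=dx_1dx_4+dx_2dx_3$, and satisfy $d_f\underline\omega=0$, $d_H\underline\omega=0$, $d_f\underline\lambda=0$, $d_H\underline\mu=0$, $d_f\underline\Theta=0$, $d_H\underline\Theta=0$. $B$ carries the metric for which these $dt_i$ are orthonormal; $I_i$ are the complex structures on the vertical tangent space with $\omega_i(u,v)=g^{fibre}(I_iu,v)$, $g^{fibre}=\sum dx_j^2$. **Formal associativity.** For $\epsilon>0$ put $g_\epsilon=\epsilon\sum dx_j^2+\sum dt_i^2$, $\phi_\epsilon=\epsilon\underline\omega+\underline\lambda$, and $*_\epsilon\phi_\epsilon=\epsilon\underline\Theta+\epsilon^2\underline\mu$, and define the alternating trilinear map $\chi_\epsilon$ on $TM$ by $g_\epsilon(\chi_\epsilon(x,y,z),w)=( *_\epsilon\phi_\epsilon)(x,y,z,w)$. A 3-dimensional submanifold with tangent basis $x,y,z$ is associative for $\phi_\epsilon$ if $\chi_\epsilon(x,y,z)=0$. The formal adiabatic limiting condition is the limit $\epsilon\to0$ of this equation for a fixed section $s$. *)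

theory Defs
  imports "HOL-Analysis.Analysis" "HOL-Library.Function_Algebras"
begin

section \<open>Pointwise vector space structure on function types\<close>

text \<open>Tangent vectors are functionals on functions and forms are functions of lists of tangent
  vectors, so both live in function types.  Their linear structure is pointwise; their topology is
  the product topology already declared in HOL-Analysis.\<close>

instantiation "fun" :: (type, real_vector) real_vector
begin
definition "scaleR r f = (\<lambda>x. r *\<^sub>R f x)"
instance
  by standard (auto simp: scaleR_fun_def fun_eq_iff scaleR_add_right scaleR_add_left)
end


section \<open>Smooth manifolds\<close>

text \<open>For open \<open>S\<close> this is \<open>C\<^sup>k\<close>: all iterated directional derivatives up to order \<open>k\<close> exist
  as Frechet derivatives and are continuous.\<close>

primrec Ck_on :: "nat \<Rightarrow> 'a::euclidean_space set \<Rightarrow> ('a \<Rightarrow> 'b::real_normed_vector) \<Rightarrow> bool" where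
  "Ck_on 0 S f = continuous_on S f"
| "Ck_on (Suc k) S f =
     ((\<forall>x\<in>S. f differentiable (at x)) \<and> (\<forall>v. Ck_on k S (\<lambda>x. frechet_derivative f (at x) v)))"

definition smooth_on :: "'a::euclidean_space set \<Rightarrow> ('a \<Rightarrow> 'b::real_normed_vector) \<Rightarrow> bool" where
  "smooth_on S f \<longleftrightarrow> (\<forall>k. Ck_on k S f)"

text \<open>The carrier is the topspace of the topology; a chart is a domain together with a map that
  is only meaningful on it.\<close>

record ('a, 'e) manifold =
  mtop :: "'a topology"
  charts :: "('a set \<times> ('a \<Rightarrow> 'e)) set"

abbreviation points :: "('a, 'e) manifold \<Rightarrow> 'a set" where
  "points M \<equiv> topspace (mtop M)"

definition smooth_manifold :: "('a, 'e::euclidean_space) manifold \<Rightarrow> bool" where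
  "smooth_manifold M \<longleftrightarrow>
     Hausdorff_space (mtop M) \<and> second_countable (mtop M) \<and>
     (\<Union>(U, c)\<in>charts M. U) = points M \<and>
     (\<forall>(U, c)\<in>charts M. openin (mtop M) U \<and> open (c ` U) \<and>
        homeomorphic_map (subtopology (mtop M) U) (top_of_set (c ` U)) c) \<and>
     (\<forall>(U, c)\<in>charts M. \<forall>(V, d)\<in>charts M. smooth_on (c ` (U \<inter> V)) (d \<circ> inv_into U c))"

definition smooth_fun :: "('a, 'e::euclidean_space) manifold \<Rightarrow> ('a \<Rightarrow> real) \<Rightarrow> bool" where
  "smooth_fun M f \<longleftrightarrow> (\<forall>(U, c)\<in>charts M. smooth_on (c ` U) (f \<circ> inv_into U c))"

definition smooth_map ::
  "('a, 'e::euclidean_space) manifold \<Rightarrow> ('b, 'f::euclidean_space) manifold \<Rightarrow> ('a \<Rightarrow> 'b) \<Rightarrow> bool"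
where
  "smooth_map M N F \<longleftrightarrow>
     continuous_map (mtop M) (mtop N) F \<and>
     (\<forall>(U, c)\<in>charts M. \<forall>(V, d)\<in>charts N.
        smooth_on (c ` (U \<inter> F -` V)) (d \<circ> F \<circ> inv_into U c))"

definition diffeomorphism ::
  "('a, 'e::euclidean_space) manifold \<Rightarrow> ('b, 'f::euclidean_space) manifold \<Rightarrow> ('a \<Rightarrow> 'b) \<Rightarrow> bool"
where
  "diffeomorphism M N F \<longleftrightarrow>
     smooth_map M N F \<and>
     (\<exists>G. smooth_map N M G \<and> (\<forall>x\<in>points M. G (F x) = x) \<and> (\<forall>y\<in>points N. F (G y) = y))"

definition open_submanifold :: "('a, 'e) manifold \<Rightarrow> 'a set \<Rightarrow> ('a, 'e) manifold" where
  "open_submanifold M W =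
     \<lparr>mtop = subtopology (mtop M) W, charts = (\<lambda>(U, c). (U \<inter> W, c)) ` charts M\<rparr>"

definition prod_manifold :: "('a, 'e) manifold \<Rightarrow> ('b, 'f) manifold \<Rightarrow> ('a \<times> 'b, 'e \<times> 'f) manifold"
where
  "prod_manifold M N =
     \<lparr>mtop = prod_topology (mtop M) (mtop N),
      charts = {(U \<times> V, map_prod c d) | U c V d. (U, c) \<in> charts M \<and> (V, d) \<in> charts N}\<rparr>"

text \<open>The induced structure of an embedded submanifold \<open>S\<close> of a Euclidean space: charts are the
  inverses of all local parametrisations, i.e. of smooth immersions that are homeomorphisms from
  open sets onto relatively open subsets of \<open>S\<close>.\<close>

definition embedded_manifold :: "'n::euclidean_space set \<Rightarrow> ('n, 'e::euclidean_space) manifold" where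
  "embedded_manifold S =
     \<lparr>mtop = top_of_set S,
      charts = {(U, c). openin (top_of_set S) U \<and> open (c ` U) \<and>
        homeomorphic_map (top_of_set U) (top_of_set (c ` U)) c \<and>
        smooth_on (c ` U) (inv_into U c) \<and>
        (\<forall>x\<in>c ` U. inj (frechet_derivative (inv_into U c) (at x)))}\<rparr>"

text \<open>The K3 manifold is the 4-manifold underlying the Fermat quartic
  \<open>z\<^sub>1\<^sup>4 + z\<^sub>2\<^sup>4 + z\<^sub>3\<^sup>4 + z\<^sub>4\<^sup>4 = 0\<close> in complex projective 3-space (all K3 surfaces are diffeomorphic).
  Projective space is embedded in the space of complex matrices by sending a line to the
  orthogonal projection onto it, \<open>[z] \<mapsto> z z\<^sup>*\<close> for \<open>|z| = 1\<close>.\<close>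

definition fermat_quartic :: "(complex^4^4) set" where
  "fermat_quartic = {P. \<exists>z :: complex^4. norm z = 1 \<and> (\<Sum>i\<in>UNIV. (z $ i) ^ 4) = 0 \<and>
                          P = (\<chi> i j. z $ i * cnj (z $ j))}"

definition K3 :: "(complex^4^4, real^4) manifold" where
  "K3 = embedded_manifold fermat_quartic"


section \<open>Tangent vectors and vector fields\<close>

text \<open>Tangent vectors at \<open>p\<close> are the derivations at \<open>p\<close> of the smooth functions; the last clause
  makes them determined, as HOL functions, by their values on smooth functions.\<close>

type_synonym 'a tvec = "('a \<Rightarrow> real) \<Rightarrow> real"

definition tangent_space :: "('a, 'e::euclidean_space) manifold \<Rightarrow> 'a \<Rightarrow> 'a tvec set" where
  "tangent_space M p = {v.
     (\<forall>f g. smooth_fun M f \<longrightarrow> smooth_fun M g \<longrightarrow>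
        v (f + g) = v f + v g \<and> v (f * g) = f p * v g + g p * v f) \<and>
     (\<forall>r f. smooth_fun M f \<longrightarrow> v (r *\<^sub>R f) = r * v f) \<and>
     (\<forall>f. \<not> smooth_fun M f \<longrightarrow> v f = 0)}"

definition pushforward ::
  "('a, 'e::euclidean_space) manifold \<Rightarrow> ('b, 'f::euclidean_space) manifold \<Rightarrow> ('a \<Rightarrow> 'b) \<Rightarrow>
   'a tvec \<Rightarrow> 'b tvec"
where
  "pushforward M N F v = (\<lambda>g. if smooth_fun N g then v (g \<circ> F) else 0)"

type_synonym 'a vfield = "'a \<Rightarrow> 'a tvec"

definition vector_field :: "('a, 'e::euclidean_space) manifold \<Rightarrow> 'a vfield \<Rightarrow> bool" where
  "vector_field M X \<longleftrightarrow>
     (\<forall>p\<in>points M. X p \<in> tangent_space M p) \<and>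
     (\<forall>f. smooth_fun M f \<longrightarrow> smooth_fun M (\<lambda>p. X p f))"

definition lie_bracket :: "'a vfield \<Rightarrow> 'a vfield \<Rightarrow> 'a vfield" where
  "lie_bracket X Y = (\<lambda>p f. X p (\<lambda>q. Y q f) - Y p (\<lambda>q. X q f))"


section \<open>Multilinear algebra and differential forms\<close>

definition linear_on :: "'v::real_vector set \<Rightarrow> ('v \<Rightarrow> real) \<Rightarrow> bool" where
  "linear_on V f \<longleftrightarrow>
     (\<forall>u\<in>V. \<forall>v\<in>V. f (u + v) = f u + f v) \<and> (\<forall>r. \<forall>v\<in>V. f (r *\<^sub>R v) = r * f v)"

definition inner_product_on :: "'v::real_vector set \<Rightarrow> ('v \<Rightarrow> 'v \<Rightarrow> real) \<Rightarrow> bool" where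
  "inner_product_on V g \<longleftrightarrow>
     (\<forall>v\<in>V. linear_on V (g v)) \<and> (\<forall>u\<in>V. \<forall>v\<in>V. g u v = g v u) \<and>
     (\<forall>v\<in>V. v \<noteq> 0 \<longrightarrow> g v v > 0)"

text \<open>\<open>\<theta> 1, \<dots>, \<theta> n\<close> is a basis of the dual space of \<open>V\<close>: linear coordinates on \<open>V\<close>.\<close>

definition coframe_on :: "'v::real_vector set \<Rightarrow> nat \<Rightarrow> (nat \<Rightarrow> 'v \<Rightarrow> real) \<Rightarrow> bool" where
  "coframe_on V n \<theta> \<longleftrightarrow>
     (\<forall>i\<in>{1..n}. linear_on V (\<theta> i)) \<and> (\<forall>c. \<exists>!v. v \<in> V \<and> (\<forall>i\<in>{1..n}. \<theta> i v = c i))"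

text \<open>An alternating \<open>k\<close>-form on \<open>V\<close> is a function of lists that vanishes on lists of length
  other than \<open>k\<close>, so its degree need not be passed around.\<close>

type_synonym 'v form = "'v list \<Rightarrow> real"

definition alternating_on :: "'v::real_vector set \<Rightarrow> nat \<Rightarrow> 'v form \<Rightarrow> bool" where
  "alternating_on V k \<alpha> \<longleftrightarrow>
     (\<forall>vs\<in>lists V. length vs \<noteq> k \<longrightarrow> \<alpha> vs = 0) \<and>
     (\<forall>vs\<in>lists V. length vs = k \<longrightarrow> (\<forall>i<k. linear_on V (\<lambda>v. \<alpha> (vs[i := v])))) \<and>
     (\<forall>vs\<in>lists V. length vs = k \<longrightarrow>
        (\<forall>i<k. \<forall>j<k. i \<noteq> j \<longrightarrow> vs ! i = vs ! j \<longrightarrow> \<alpha> vs = 0))"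

definition covector :: "('v \<Rightarrow> real) \<Rightarrow> 'v form" where
  "covector \<theta> = (\<lambda>vs. case vs of [v] \<Rightarrow> \<theta> v | _ \<Rightarrow> 0)"

text \<open>The exterior product as a sum over shuffles: \<open>A\<close> is the set of positions fed to the first
  factor, with the sign of the corresponding shuffle.  With this normalisation
  \<open>(\<theta>\<^sub>1 \<and> \<dots> \<and> \<theta>\<^sub>k)(v\<^sub>1, \<dots>, v\<^sub>k) = det (\<theta>\<^sub>i v\<^sub>j)\<close>.\<close>

definition shuffle_sign :: "nat \<Rightarrow> nat set \<Rightarrow> real" where
  "shuffle_sign n A = (-1) ^ card {(i, j). i \<in> A \<and> j \<in> {..<n} - A \<and> j < i}"

definition wedge :: "'v form \<Rightarrow> 'v form \<Rightarrow> 'v form"  (infixr \<open>\<and>\<^sub>f\<close> 70) where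
  "(\<alpha> \<and>\<^sub>f \<beta>) = (\<lambda>vs. \<Sum>A\<in>Pow {..<length vs}.
      shuffle_sign (length vs) A * \<alpha> (nths vs A) * \<beta> (nths vs (- A)))"

type_synonym 'a dform = "'a \<Rightarrow> 'a tvec form"

definition differential_form :: "('a, 'e::euclidean_space) manifold \<Rightarrow> nat \<Rightarrow> 'a dform \<Rightarrow> bool" where
  "differential_form M k \<alpha> \<longleftrightarrow>
     (\<forall>p\<in>points M. alternating_on (tangent_space M p) k (\<alpha> p)) \<and>
     (\<forall>Xs. length Xs = k \<longrightarrow> (\<forall>X\<in>set Xs. vector_field M X) \<longrightarrow>
        smooth_fun M (\<lambda>p. \<alpha> p (map (\<lambda>X. X p) Xs)))"

definition vanishes :: "('a, 'e::euclidean_space) manifold \<Rightarrow> 'a dform \<Rightarrow> bool" where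
  "vanishes M \<alpha> \<longleftrightarrow> (\<forall>p\<in>points M. \<forall>vs\<in>lists (tangent_space M p). \<alpha> p vs = 0)"

definition remove_nth :: "nat \<Rightarrow> 'c list \<Rightarrow> 'c list" where
  "remove_nth i xs = take i xs @ drop (Suc i) xs"

text \<open>The exterior derivative by the invariant formula, evaluated on any smooth vector fields
  extending the given tangent vectors (the result does not depend on the extension).\<close>

definition ext_deriv :: "('a, 'e::euclidean_space) manifold \<Rightarrow> 'a dform \<Rightarrow> 'a dform" where
  "ext_deriv M \<alpha> = (\<lambda>p vs.
     let n = length vs;
         Xs = (SOME Xs. (\<forall>X\<in>set Xs. vector_field M X) \<and> map (\<lambda>X. X p) Xs = vs)
     in (\<Sum>i<n. (-1) ^ i * (Xs ! i) p (\<lambda>q. \<alpha> q (map (\<lambda>X. X q) (remove_nth i Xs)))) +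
        (\<Sum>j<n. \<Sum>i<j. (-1) ^ (i + j) *
           \<alpha> p (map (\<lambda>X. X p)
             (lie_bracket (Xs ! i) (Xs ! j) # remove_nth i (remove_nth j Xs)))))"


section \<open>Donaldson's adiabatic fibrations\<close>

text \<open>\<open>orient\<close> is a nowhere vanishing 3-form on the base representing its orientation;
  \<open>base_metric\<close> is the metric on \<open>B\<close> and \<open>fibre_metric\<close> is \<open>\<Sum>\<^sub>j dx\<^sub>j\<^sup>2\<close>, as a bilinear form on \<open>TM\<close>
  that is zero on \<open>H\<close>.  Both metrics are determined by the four forms through the clauses for
  them in \<open>adapted_coframe\<close>.\<close>

record ('b, 'm) fibration =
  base :: "('b, real^3) manifold"
  total :: "('m, real^7) manifold"
  proj :: "'m \<Rightarrow> 'b"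
  hor :: "'m \<Rightarrow> 'm tvec set"
  orient :: "'b dform"
  base_metric :: "'b \<Rightarrow> 'b tvec \<Rightarrow> 'b tvec \<Rightarrow> real"
  fibre_metric :: "'m \<Rightarrow> 'm tvec \<Rightarrow> 'm tvec \<Rightarrow> real"
  omega :: "'m dform"
  lam :: "'m dform"
  Theta :: "'m dform"
  mu :: "'m dform"

abbreviation TB :: "('b, 'm) fibration \<Rightarrow> 'b \<Rightarrow> 'b tvec set" where
  "TB D \<equiv> tangent_space (base D)"

abbreviation TM :: "('b, 'm) fibration \<Rightarrow> 'm \<Rightarrow> 'm tvec set" where
  "TM D \<equiv> tangent_space (total D)"

abbreviation dproj :: "('b, 'm) fibration \<Rightarrow> 'm tvec \<Rightarrow> 'b tvec" where
  "dproj D \<equiv> pushforward (total D) (base D) (proj D)"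

definition K3_bundle :: "('b, 'm) fibration \<Rightarrow> bool" where
  "K3_bundle D \<longleftrightarrow>
     smooth_manifold (base D) \<and> smooth_manifold (total D) \<and>
     smooth_map (total D) (base D) (proj D) \<and>
     (\<forall>b\<in>points (base D). \<exists>U \<Phi>. openin (mtop (base D)) U \<and> b \<in> U \<and>
        diffeomorphism (open_submanifold (total D) (proj D -` U))
                       (prod_manifold (open_submanifold (base D) U) K3) \<Phi> \<and>
        (\<forall>x\<in>points (total D). proj D x \<in> U \<longrightarrow> fst (\<Phi> x) = proj D x))"

definition vert :: "('b, 'm) fibration \<Rightarrow> 'm \<Rightarrow> 'm tvec set" where
  "vert D x = {v \<in> TM D x. dproj D v = 0}"

definition ehresmann_connection :: "('b, 'm) fibration \<Rightarrow> bool" where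
  "ehresmann_connection D \<longleftrightarrow>
     (\<forall>x\<in>points (total D).
        subspace (hor D x) \<and> hor D x \<subseteq> TM D x \<and> hor D x \<inter> vert D x = {0} \<and>
        (\<forall>v\<in>TM D x. \<exists>h\<in>hor D x. v - h \<in> vert D x) \<and>
        (\<exists>W S. openin (mtop (total D)) W \<and> x \<in> W \<and> finite S \<and>
           (\<forall>X\<in>S. vector_field (total D) X) \<and> (\<forall>y\<in>W. hor D y = span ((\<lambda>X. X y) ` S))))"

definition hpart :: "('b, 'm) fibration \<Rightarrow> 'm \<Rightarrow> 'm tvec \<Rightarrow> 'm tvec" where
  "hpart D x v = (THE h. h \<in> hor D x \<and> v - h \<in> vert D x)"

definition vpart :: "('b, 'm) fibration \<Rightarrow> 'm \<Rightarrow> 'm tvec \<Rightarrow> 'm tvec" where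
  "vpart D x v = v - hpart D x v"

definition hlift :: "('b, 'm) fibration \<Rightarrow> 'm \<Rightarrow> 'b tvec \<Rightarrow> 'm tvec" where
  "hlift D x e = (THE h. h \<in> hor D x \<and> dproj D h = e)"

text \<open>The component of a \<open>(p + q)\<close>-form in \<open>\<Omega>\<^bsup>p,q\<^esup>\<close>.\<close>

definition bicomp :: "('b, 'm) fibration \<Rightarrow> nat \<Rightarrow> nat \<Rightarrow> 'm dform \<Rightarrow> 'm dform" where
  "bicomp D p q \<alpha> = (\<lambda>x vs. if length vs = p + q then
     (\<Sum>A | A \<subseteq> {..<p + q} \<and> card A = p.
        \<alpha> x (map (\<lambda>i. if i \<in> A then hpart D x (vs ! i) else vpart D x (vs ! i)) [0..<p + q]))
     else 0)"

definition bigraded_form :: "('b, 'm) fibration \<Rightarrow> nat \<Rightarrow> nat \<Rightarrow> 'm dform \<Rightarrow> bool" where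
  "bigraded_form D p q \<alpha> \<longleftrightarrow>
     differential_form (total D) (p + q) \<alpha> \<and> vanishes (total D) (\<alpha> - bicomp D p q \<alpha>)"

text \<open>The parts of \<open>d\<close> of bidegree \<open>(0,1)\<close> and \<open>(1,0)\<close>, on \<open>\<Omega>\<^bsup>p,q\<^esup>\<close>.\<close>

definition d_f :: "('b, 'm) fibration \<Rightarrow> nat \<Rightarrow> nat \<Rightarrow> 'm dform \<Rightarrow> 'm dform" where
  "d_f D p q \<alpha> = bicomp D p (q + 1) (ext_deriv (total D) \<alpha>)"

definition d_H :: "('b, 'm) fibration \<Rightarrow> nat \<Rightarrow> nat \<Rightarrow> 'm dform \<Rightarrow> 'm dform" where
  "d_H D p q \<alpha> = bicomp D (p + 1) q (ext_deriv (total D) \<alpha>)"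

definition model_omega :: "(nat \<Rightarrow> 'v \<Rightarrow> real) \<Rightarrow> nat \<Rightarrow> 'v form" where
  "model_omega dx i = (let e = (\<lambda>j. covector (dx j)) in
     if i = 1 then (e 1 \<and>\<^sub>f e 2) + (e 3 \<and>\<^sub>f e 4)
     else if i = 2 then (e 1 \<and>\<^sub>f e 3) - (e 2 \<and>\<^sub>f e 4)
     else (e 1 \<and>\<^sub>f e 4) + (e 2 \<and>\<^sub>f e 3))"

definition adapted_coframe ::
  "('b, 'm) fibration \<Rightarrow> 'm \<Rightarrow> (nat \<Rightarrow> 'b tvec \<Rightarrow> real) \<Rightarrow> (nat \<Rightarrow> 'm tvec \<Rightarrow> real) \<Rightarrow> bool"
where
  "adapted_coframe D x dt dx \<longleftrightarrow>
     (let b = proj D x;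
          \<tau> = (\<lambda>i. covector (\<lambda>v. dt i (dproj D v)));
          \<omega> = model_omega dx
      in coframe_on (TB D b) 3 dt \<and>
         coframe_on (vert D x) 4 dx \<and>
         (\<forall>j\<in>{1..4}. linear_on (TM D x) (dx j) \<and> (\<forall>v\<in>hor D x. dx j v = 0)) \<and>
         (\<forall>us\<in>lists (TB D b).
            (covector (dt 1) \<and>\<^sub>f covector (dt 2) \<and>\<^sub>f covector (dt 3)) us > 0 \<longleftrightarrow> orient D b us > 0) \<and>
         (\<forall>u\<in>TB D b. \<forall>v\<in>TB D b. base_metric D b u v = (\<Sum>i=1..3. dt i u * dt i v)) \<and>
         (\<forall>u\<in>TM D x. \<forall>v\<in>TM D x. fibre_metric D x u v = (\<Sum>j=1..4. dx j u * dx j v)) \<and>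
         (\<forall>vs\<in>lists (TM D x).
            omega D x vs = ((\<omega> 1 \<and>\<^sub>f \<tau> 1) + (\<omega> 2 \<and>\<^sub>f \<tau> 2) + (\<omega> 3 \<and>\<^sub>f \<tau> 3)) vs \<and>
            lam D x vs = - (\<tau> 1 \<and>\<^sub>f \<tau> 2 \<and>\<^sub>f \<tau> 3) vs \<and>
            Theta D x vs = - ((\<omega> 1 \<and>\<^sub>f \<tau> 2 \<and>\<^sub>f \<tau> 3) + (\<omega> 2 \<and>\<^sub>f \<tau> 3 \<and>\<^sub>f \<tau> 1)
                              + (\<omega> 3 \<and>\<^sub>f \<tau> 1 \<and>\<^sub>f \<tau> 2)) vs \<and>
            mu D x vs = 1/2 * (\<omega> 1 \<and>\<^sub>f \<omega> 1) vs))"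

definition donaldson_fibration :: "('b, 'm) fibration \<Rightarrow> bool" where
  "donaldson_fibration D \<longleftrightarrow>
     K3_bundle D \<and>
     contractible_space (mtop (base D)) \<and>
     differential_form (base D) 3 (orient D) \<and>
     (\<forall>b\<in>points (base D). \<exists>us\<in>lists (TB D b). orient D b us \<noteq> 0) \<and>
     (\<forall>b\<in>points (base D). inner_product_on (TB D b) (base_metric D b)) \<and>
     (\<forall>X Y. vector_field (base D) X \<longrightarrow> vector_field (base D) Y \<longrightarrow>
        smooth_fun (base D) (\<lambda>b. base_metric D b (X b) (Y b))) \<and>
     ehresmann_connection D \<and>
     bigraded_form D 1 2 (omega D) \<and> bigraded_form D 3 0 (lam D) \<and>
     bigraded_form D 2 2 (Theta D) \<and> bigraded_form D 0 4 (mu D) \<and>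
     (\<forall>x\<in>points (total D). \<exists>dt dx. adapted_coframe D x dt dx) \<and>
     vanishes (total D) (d_f D 1 2 (omega D)) \<and> vanishes (total D) (d_H D 1 2 (omega D)) \<and>
     vanishes (total D) (d_f D 3 0 (lam D)) \<and> vanishes (total D) (d_H D 0 4 (mu D)) \<and>
     vanishes (total D) (d_f D 2 2 (Theta D)) \<and> vanishes (total D) (d_H D 2 2 (Theta D))"

definition smooth_section :: "('b, 'm) fibration \<Rightarrow> ('b \<Rightarrow> 'm) \<Rightarrow> bool" where
  "smooth_section D s \<longleftrightarrow>
     smooth_map (base D) (total D) s \<and> (\<forall>b\<in>points (base D). proj D (s b) = b)"

abbreviation dsec :: "('b, 'm) fibration \<Rightarrow> ('b \<Rightarrow> 'm) \<Rightarrow> 'b tvec \<Rightarrow> 'm tvec" where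
  "dsec D s \<equiv> pushforward (base D) (total D) s"

definition oriented_orthonormal_basis :: "('b, 'm) fibration \<Rightarrow> 'b \<Rightarrow> (nat \<Rightarrow> 'b tvec) \<Rightarrow> bool" where
  "oriented_orthonormal_basis D b e \<longleftrightarrow>
     (\<forall>i\<in>{1..3}. e i \<in> TB D b) \<and>
     (\<forall>i\<in>{1..3}. \<forall>j\<in>{1..3}. base_metric D b (e i) (e j) = (if i = j then 1 else 0)) \<and>
     orient D b [e 1, e 2, e 3] > 0"


section \<open>Formal associativity and the Fueter operator\<close>

definition g_eps :: "('b, 'm) fibration \<Rightarrow> real \<Rightarrow> 'm \<Rightarrow> 'm tvec \<Rightarrow> 'm tvec \<Rightarrow> real" where
  "g_eps D \<epsilon> x u v =
     \<epsilon> * fibre_metric D x u v + base_metric D (proj D x) (dproj D u) (dproj D v)"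

definition star_phi :: "('b, 'm) fibration \<Rightarrow> real \<Rightarrow> 'm dform" where
  "star_phi D \<epsilon> x = \<epsilon> *\<^sub>R Theta D x + \<epsilon>\<^sup>2 *\<^sub>R mu D x"

definition chi_eps ::
  "('b, 'm) fibration \<Rightarrow> real \<Rightarrow> 'm \<Rightarrow> 'm tvec \<Rightarrow> 'm tvec \<Rightarrow> 'm tvec \<Rightarrow> 'm tvec"
where
  "chi_eps D \<epsilon> x u v w =
     (THE c. c \<in> TM D x \<and> (\<forall>y\<in>TM D x. g_eps D \<epsilon> x c y = star_phi D \<epsilon> x [u, v, w, y]))"

definition chi_section ::
  "('b, 'm) fibration \<Rightarrow> ('b \<Rightarrow> 'm) \<Rightarrow> 'b \<Rightarrow> (nat \<Rightarrow> 'b tvec) \<Rightarrow> real \<Rightarrow> 'm tvec"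
where
  "chi_section D s b e \<epsilon> =
     chi_eps D \<epsilon> (s b) (dsec D s (e 1)) (dsec D s (e 2)) (dsec D s (e 3))"

text \<open>For \<open>e = \<partial>/\<partial>t\<^sub>i\<close> in the basis dual to \<open>dt\<^sub>1, dt\<^sub>2, dt\<^sub>3\<close>, this is the coefficient \<open>\<omega>\<^sub>i\<close> in
  \<open>omega = \<Sum>\<^sub>i \<omega>\<^sub>i \<and> dt\<^sub>i\<close> on vertical vectors.\<close>

definition omega_comp :: "('b, 'm) fibration \<Rightarrow> 'm \<Rightarrow> 'b tvec \<Rightarrow> 'm tvec \<Rightarrow> 'm tvec \<Rightarrow> real" where
  "omega_comp D x e u v = omega D x [u, v, hlift D x e]"

definition cplx_str :: "('b, 'm) fibration \<Rightarrow> 'm \<Rightarrow> 'b tvec \<Rightarrow> 'm tvec \<Rightarrow> 'm tvec" where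
  "cplx_str D x e u =
     (THE w. w \<in> vert D x \<and> (\<forall>v\<in>vert D x. omega_comp D x e u v = fibre_metric D x w v))"

definition nabla :: "('b, 'm) fibration \<Rightarrow> ('b \<Rightarrow> 'm) \<Rightarrow> 'b \<Rightarrow> 'b tvec \<Rightarrow> 'm tvec" where
  "nabla D s b e = vpart D (s b) (dsec D s e)"

end

theory Submission
  imports Defs
begin

text \<open>
  Put \<open>S = \<Sum>\<^sub>i I\<^sub>i \<nabla>\<^sub>i s\<close>. On a vertical vector \<open>y\<close> only \<open>\<epsilon> \<Theta>\<close> contributes to the leading order of
  \<open>*\<phi>(ds \<partial>\<^sub>1, ds \<partial>\<^sub>2, ds \<partial>\<^sub>3, y)\<close>. The adapted coframe \<open>dt\<close> and the basis \<open>\<partial>\<^sub>i\<close> differ by a matrix in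
  \<open>SO(3)\<close>, which equals its own cofactor matrix; hence
  \<open>\<Theta>(ds \<partial>\<^sub>1, ds \<partial>\<^sub>2, ds \<partial>\<^sub>3, y) = - \<Sum>\<^sub>i \<omega>\<^sub>i(\<nabla>\<^sub>i s, y)\<close>, i.e. minus the fibre inner product of
  \<open>S\<close> and \<open>y\<close>. Raising the index with the rescaled metric divides vertical components by \<open>\<epsilon>\<close> and leaves
  horizontal ones of order \<open>\<epsilon>\<close>, so \<open>\<chi>\<^sub>\<epsilon>\<close> converges to \<open>-S\<close>.
\<close>

section \<open>Smooth maps and tangent spaces\<close>

lemma Ck_on_Suc_imp: "Ck_on (Suc k) S f \<Longrightarrow> Ck_on k S f"
proof (induction k arbitrary: f)
  case 0
  then show ?case
    by (auto intro!: continuous_at_imp_continuous_on differentiable_imp_continuous_within)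
next
  case (Suc k)
  then show ?case
    unfolding Ck_on.simps(2)[of "Suc k"] Ck_on.simps(2)[of k] by blast
qed

lemma has_derivative_cong_open:
  assumes "open S" "\<And>y. y \<in> S \<Longrightarrow> f y = g y" "x \<in> S"
  shows "(f has_derivative D) (at x) \<longleftrightarrow> (g has_derivative D) (at x)"
  using assms has_derivative_transform_within_open by metis

text \<open>Derivatives in \<open>Ck_on\<close> are taken in the whole ambient space; the values on
  \<open>S\<close> determine them because \<open>S\<close> is a neighbourhood of each of its
  points.\<close>

lemma Ck_on_cong:
  assumes "open S" "\<And>x. x \<in> S \<Longrightarrow> f x = g x"
  shows "Ck_on k S f \<longleftrightarrow> Ck_on k S g"
  using assms(2)
proof (induction k arbitrary: f g)
  case 0
  then show ?case
    by (simp cong: continuous_on_cong)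
next
  case (Suc k)
  have D: "(f has_derivative D) (at x) \<longleftrightarrow> (g has_derivative D) (at x)" if "x \<in> S" for x D
    using has_derivative_cong_open[OF assms(1) Suc.prems that] .
  then have "f differentiable (at x) \<longleftrightarrow> g differentiable (at x)" if "x \<in> S" for x
    using that by (simp add: differentiable_def)
  moreover have "frechet_derivative f (at x) = frechet_derivative g (at x)" if "x \<in> S" for x
    using that by (simp add: frechet_derivative_def D)
  then have "Ck_on k S (\<lambda>x. frechet_derivative f (at x) v) \<longleftrightarrow>
      Ck_on k S (\<lambda>x. frechet_derivative g (at x) v)" for v
    by (intro Suc.IH) simp
  ultimately show ?case
    by simp
qed

text \<open>Each clause of \<open>Ck_on\<close> can be tested near a single point. This is meant for
  maps between manifolds, where the chart of the target changes from point to point.\<close>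

lemma Ck_on_local:
  assumes "\<And>x. x \<in> S \<Longrightarrow> \<exists>T. open T \<and> x \<in> T \<and> Ck_on k T f"
  shows "Ck_on k S f"
  using assms
proof (induction k arbitrary: f)
  case 0
  then show ?case
    by (auto intro!: continuous_at_imp_continuous_on) (meson continuous_on_eq_continuous_at)
next
  case (Suc k)
  have "f differentiable (at x)" if "x \<in> S" for x
    using Suc.prems[OF that] by auto
  moreover have "Ck_on k S (\<lambda>x. frechet_derivative f (at x) v)" for v
    using Suc.prems by (intro Suc.IH) (fastforce simp: Ck_on.simps(2))
  ultimately show ?case
    by simp
qed

text \<open>By uniqueness of derivatives, any explicit formula \<open>f'\<close> may replace the
  chosen \<open>frechet_derivative\<close>; this drives the inductions on \<open>k\<close>
  below.\<close>

lemma Ck_on_SucI: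
  assumes "open S" "\<And>x. x \<in> S \<Longrightarrow> (f has_derivative f' x) (at x)"
    and "\<And>v. Ck_on k S (\<lambda>x. f' x v)"
  shows "Ck_on (Suc k) S f"
proof -
  have "frechet_derivative f (at x) = f' x" if "x \<in> S" for x
    using frechet_derivative_at[OF assms(2)[OF that]] by simp
  then have "Ck_on k S (\<lambda>x. frechet_derivative f (at x) v)" for v
    using Ck_on_cong[OF assms(1), of "\<lambda>x. frechet_derivative f (at x) v" "\<lambda>x. f' x v"]
      assms(3) by simp
  then show ?thesis
    using assms(2) by (auto simp: differentiable_def)
qed

lemma Ck_on_SucD:
  assumes "Ck_on (Suc k) S f"
  shows "x \<in> S \<Longrightarrow> (f has_derivative frechet_derivative f (at x)) (at x)"
    and "Ck_on k S (\<lambda>x. frechet_derivative f (at x) v)"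
  using assms by (simp_all add: frechet_derivative_works)

lemma Ck_on_const: "open S \<Longrightarrow> Ck_on k S (\<lambda>_. c)"
proof (induction k arbitrary: c)
  case (Suc k)
  show ?case
    by (rule Ck_on_SucI[OF Suc.prems has_derivative_const Suc.IH[OF Suc.prems]])
qed simp

lemma Ck_on_add:
  assumes "open S"
  shows "Ck_on k S f \<Longrightarrow> Ck_on k S g \<Longrightarrow> Ck_on k S (\<lambda>x. f x + g x)"
proof (induction k arbitrary: f g)
  case 0
  then show ?case
    by (simp add: continuous_on_add)
next
  case (Suc k)
  show ?case
    by (rule Ck_on_SucI[OF assms has_derivative_add[OF Ck_on_SucD(1)[OF Suc.prems(1)]
            Ck_on_SucD(1)[OF Suc.prems(2)]]])
      (auto intro: Suc.IH Ck_on_SucD(2)[OF Suc.prems(1)] Ck_on_SucD(2)[OF Suc.prems(2)])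
qed

lemma Ck_on_sum:
  assumes "open S" "\<And>i. i \<in> I \<Longrightarrow> Ck_on k S (f i)"
  shows "Ck_on k S (\<lambda>x. \<Sum>i\<in>I. f i x)"
  using assms(2)
  by (induction I rule: infinite_finite_induct)
    (simp_all add: Ck_on_const[OF assms(1)] Ck_on_add[OF assms(1)])

lemma Ck_on_scaleR:
  assumes "open S"
  shows "Ck_on k S f \<Longrightarrow> Ck_on k S g \<Longrightarrow> Ck_on k S (\<lambda>x. f x *\<^sub>R g x)"
proof (induction k arbitrary: f g)
  case 0
  then show ?case
    by (simp add: continuous_on_scaleR)
next
  case (Suc k)
  show ?case
  proof (rule Ck_on_SucI[OF assms has_derivative_scaleR[OF Ck_on_SucD(1)[OF Suc.prems(1)]
          Ck_on_SucD(1)[OF Suc.prems(2)]]])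
    show "Ck_on k S (\<lambda>x. f x *\<^sub>R frechet_derivative g (at x) v +
        frechet_derivative f (at x) v *\<^sub>R g x)" for v
      by (intro Ck_on_add[OF assms] Suc.IH Ck_on_SucD(2)[OF Suc.prems(1)]
          Ck_on_SucD(2)[OF Suc.prems(2)] Ck_on_Suc_imp[OF Suc.prems(1)]
          Ck_on_Suc_imp[OF Suc.prems(2)])
  qed
qed

lemma Ck_on_inner_const:
  assumes "open S"
  shows "Ck_on k S f \<Longrightarrow> Ck_on k S (\<lambda>x. f x \<bullet> c)"
proof (induction k arbitrary: f)
  case 0
  then show ?case
    by (simp add: continuous_on_inner)
next
  case (Suc k)
  show ?case
    by (rule Ck_on_SucI[OF assms has_derivative_inner_left[OF Ck_on_SucD(1)[OF Suc.prems]]])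
      (auto intro: Suc.IH Ck_on_SucD(2)[OF Suc.prems])
qed

text \<open>Induction with the chain rule. The direction \<open>f' x v\<close> fed to
  \<open>g'\<close> moves with \<open>x\<close>, while \<open>Ck_on\<close> speaks of fixed
  directions; expanding it in \<open>Basis\<close> leaves sums of products of maps covered by the
  induction hypothesis.\<close>

lemma Ck_on_compose:
  fixes f :: "'a::euclidean_space \<Rightarrow> 'b::euclidean_space"
    and g :: "'b \<Rightarrow> 'c::real_normed_vector"
  assumes "open S" "f ` S \<subseteq> T"
  shows "Ck_on k S f \<Longrightarrow> Ck_on k T g \<Longrightarrow> Ck_on k S (\<lambda>x. g (f x))"
proof (induction k arbitrary: g)
  case 0
  then show ?case
    using continuous_on_compose2[OF _ _ assms(2)] by simp
next
  case (Suc k)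
  define g' where "g' y = frechet_derivative g (at y)" for y
  define f' where "f' x = frechet_derivative f (at x)" for x
  have f': "(f has_derivative f' x) (at x)" if "x \<in> S" for x
    using Ck_on_SucD(1)[OF Suc.prems(1) that] by (simp add: f'_def)
  have g': "(g has_derivative g' (f x)) (at (f x))" if "x \<in> S" for x
    using Ck_on_SucD(1)[OF Suc.prems(2)] that assms(2) by (auto simp: g'_def)
  show ?case
  proof (rule Ck_on_SucI[OF assms(1)])
    fix x assume "x \<in> S"
    then show "((\<lambda>x. g (f x)) has_derivative (\<lambda>v. g' (f x) (f' x v))) (at x)"
      using has_derivative_compose f' g' by blast
  next
    fix v
    have "g' (f x) (f' x v) = (\<Sum>i\<in>Basis. (f' x v \<bullet> i) *\<^sub>R g' (f x) i)" if "x \<in> S" for x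
    proof -
      have "linear (g' (f x))"
        using g'[OF that] by (rule has_derivative_linear)
      then have "g' (f x) (\<Sum>i\<in>Basis. (f' x v \<bullet> i) *\<^sub>R i) =
          (\<Sum>i\<in>Basis. (f' x v \<bullet> i) *\<^sub>R g' (f x) i)"
        by (simp add: linear_sum linear_scale)
      then show ?thesis
        by (simp add: euclidean_representation)
    qed
    moreover have "Ck_on k S (\<lambda>x. \<Sum>i\<in>Basis. (f' x v \<bullet> i) *\<^sub>R g' (f x) i)"
      unfolding f'_def g'_def
      by (intro Ck_on_sum Ck_on_scaleR Ck_on_inner_const assms(1) Suc.IH
          Ck_on_SucD(2)[OF Suc.prems(1)] Ck_on_SucD(2)[OF Suc.prems(2)]
          Ck_on_Suc_imp[OF Suc.prems(1)])
    ultimately show "Ck_on k S (\<lambda>x. g' (f x) (f' x v))"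
      by (subst Ck_on_cong[OF assms(1)])
  qed
qed

section \<open>Charts, smooth functions and derivations\<close>

lemma smooth_manifold_chart:
  assumes "smooth_manifold M" "(U, c) \<in> charts M"
  shows "U \<subseteq> points M" "open (c ` U)" "inj_on c U"
    "W \<subseteq> U \<Longrightarrow> openin (mtop M) W \<Longrightarrow> open (c ` W)"
proof -
  have U: "openin (mtop M) U" and o: "open (c ` U)"
    and h: "homeomorphic_map (subtopology (mtop M) U) (top_of_set (c ` U)) c"
    using assms by (auto simp: smooth_manifold_def)
  show "U \<subseteq> points M"
    using U openin_subset by blast
  then show "inj_on c U"
    using h homeomorphic_imp_injective_map by (fastforce simp: Int_absorb1)
  show "open (c ` U)" by (rule o)
  show "open (c ` W)" if "W \<subseteq> U" "openin (mtop M) W"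
  proof -
    have "openin (subtopology (mtop M) U) W"
      using that U openin_open_subtopology by blast
    then have "openin (top_of_set (c ` U)) (c ` W)"
      using h homeomorphic_imp_open_map open_map_def by blast
    then show ?thesis
      using o openin_open_eq by blast
  qed
qed

lemma smooth_fun_cong:
  assumes "smooth_manifold M" "\<And>p. p \<in> points M \<Longrightarrow> f p = g p"
  shows "smooth_fun M f \<longleftrightarrow> smooth_fun M g"
proof -
  have "smooth_on (c ` U) (f \<circ> inv_into U c) \<longleftrightarrow> smooth_on (c ` U) (g \<circ> inv_into U c)"
    if "(U, c) \<in> charts M" for U c
  proof -
    have "(f \<circ> inv_into U c) x = (g \<circ> inv_into U c) x" if "x \<in> c ` U" for x
      using assms(2) smooth_manifold_chart(1)[OF assms(1) \<open>(U, c) \<in> charts M\<close>] inv_into_into[OF that] by auto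
    then show ?thesis
      unfolding smooth_on_def using Ck_on_cong[OF smooth_manifold_chart(2)[OF assms(1) that]] by blast
  qed
  then show ?thesis
    unfolding smooth_fun_def by blast
qed

lemma smooth_fun_const:
  assumes "smooth_manifold M"
  shows "smooth_fun M (\<lambda>_. c)"
  using smooth_manifold_chart(2)[OF assms]
  by (auto simp: smooth_fun_def smooth_on_def comp_def intro!: Ck_on_const)

lemma smooth_fun_add:
  assumes "smooth_manifold M" "smooth_fun M f" "smooth_fun M g"
  shows "smooth_fun M (f + g)"
  using assms smooth_manifold_chart(2)[OF assms(1)]
  by (auto simp: smooth_fun_def smooth_on_def comp_def plus_fun_def intro!: Ck_on_add)

lemma smooth_fun_mult:
  assumes "smooth_manifold M" "smooth_fun M f" "smooth_fun M g"
  shows "smooth_fun M (f * g)"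
  using assms smooth_manifold_chart(2)[OF assms(1)]
  by (auto simp: smooth_fun_def smooth_on_def comp_def times_fun_def
      intro!: Ck_on_scaleR[where 'b = real, simplified])

lemma smooth_fun_scaleR:
  assumes "smooth_manifold M" "smooth_fun M f"
  shows "smooth_fun M (r *\<^sub>R f)"
  using smooth_fun_mult[OF assms(1) smooth_fun_const[OF assms(1)] assms(2)]
  by (simp add: times_fun_def scaleR_fun_def)

text \<open>Around \<open>p\<close>, with a chart \<open>(V, d)\<close> of \<open>N\<close> at
  \<open>F p\<close>, the coordinate form of \<open>g \<circ> F\<close> is that of \<open>g\<close>
  after that of \<open>F\<close>; the local pieces are glued by \<open>Ck_on_local\<close>.\<close>

lemma smooth_fun_compose:
  assumes M: "smooth_manifold M" and N: "smooth_manifold N"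
    and F: "smooth_map M N F" and g: "smooth_fun N g"
  shows "smooth_fun M (g \<circ> F)"
  unfolding smooth_fun_def smooth_on_def
proof (clarify, rule Ck_on_local)
  fix U c k x assume U: "(U, c) \<in> charts M" and x: "x \<in> c ` U"
  define p where "p = inv_into U c x"
  have p: "p \<in> U" "c p = x"
    using x by (simp_all add: p_def inv_into_into f_inv_into_f)
  have cont: "continuous_map (mtop M) (mtop N) F"
    using F by (simp add: smooth_map_def)
  have "F p \<in> points N"
    using cont p(1) smooth_manifold_chart(1)[OF M U] by (auto simp: continuous_map_def)
  moreover have "(\<Union>(V, d)\<in>charts N. V) = points N"
    using N by (simp add: smooth_manifold_def)
  ultimately obtain V d where V: "(V, d) \<in> charts N" "F p \<in> V"
    by blast
  have "openin (mtop N) V" "openin (mtop M) U"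
    using V U N M by (auto simp: smooth_manifold_def)
  then have "openin (mtop M) (U \<inter> {q \<in> points M. F q \<in> V})"
    using cont by (intro openin_Int) (auto simp: continuous_map_def)
  \<comment> \<open>The preimage of \<open>V\<close> may contain elements of the type outside the
    carrier; intersecting with \<open>U\<close> removes them.\<close>
  moreover have "U \<inter> {q \<in> points M. F q \<in> V} = U \<inter> F -` V"
    using smooth_manifold_chart(1)[OF M U] by auto
  ultimately have op: "open (c ` (U \<inter> F -` V))"
    using smooth_manifold_chart(4)[OF M U, of "U \<inter> F -` V"] by simp
  have inv: "inv_into U c y \<in> U \<inter> F -` V" if "y \<in> c ` (U \<inter> F -` V)" for y
    using that smooth_manifold_chart(3)[OF M U] by auto
  have "Ck_on k (c ` (U \<inter> F -` V)) (d \<circ> F \<circ> inv_into U c)"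
    using F U V(1) unfolding smooth_map_def smooth_on_def by fast
  moreover have "Ck_on k (d ` V) (g \<circ> inv_into V d)"
    using g V(1) unfolding smooth_fun_def smooth_on_def by fast
  moreover have "(d \<circ> F \<circ> inv_into U c) ` c ` (U \<inter> F -` V) \<subseteq> d ` V"
    using inv by force
  ultimately have "Ck_on k (c ` (U \<inter> F -` V))
      (\<lambda>y. (g \<circ> inv_into V d) ((d \<circ> F \<circ> inv_into U c) y))"
    using Ck_on_compose[OF op] by blast
  moreover have "(g \<circ> inv_into V d) ((d \<circ> F \<circ> inv_into U c) y) = (g \<circ> F \<circ> inv_into U c) y"
    if "y \<in> c ` (U \<inter> F -` V)" for y
    using inv[OF that] smooth_manifold_chart(3)[OF N V(1)] by simp
  ultimately have "Ck_on k (c ` (U \<inter> F -` V)) (g \<circ> F \<circ> inv_into U c)"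
    by (rule iffD1[OF Ck_on_cong[OF op], rotated])
  then show "\<exists>T. open T \<and> x \<in> T \<and> Ck_on k T (g \<circ> F \<circ> inv_into U c)"
    using op p V(2) by blast
qed

text \<open>\<open>f\<close> and \<open>g\<close> may differ off the carrier, so this is more than
  congruence. Let \<open>h\<close> be their difference and \<open>k\<close> the indicator of the
  carrier, which is smooth. Then \<open>h * k\<close> vanishes everywhere, and the Leibniz rule at
  \<open>p\<close> gives \<open>0 = h p * v k + k p * v h = v h\<close>.\<close>

lemma tangent_space_pointwise:
  assumes "smooth_manifold M" "v \<in> tangent_space M p" "p \<in> points M"
    and eq: "\<And>q. q \<in> points M \<Longrightarrow> f q = g q"
  shows "v f = v g"
proof (cases "smooth_fun M f")
  case False
  then show ?thesis
    using smooth_fun_cong[OF assms(1), of f g] eq assms(2) by (auto simp: tangent_space_def)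
next
  case True
  then have g: "smooth_fun M g"
    using smooth_fun_cong[OF assms(1), of f g] eq by blast
  define h where "h = f + (-1) *\<^sub>R g"
  define k :: "'a \<Rightarrow> real" where "k q = (if q \<in> points M then 1 else 0)" for q
  have "smooth_fun M (\<lambda>_. 1) \<longleftrightarrow> smooth_fun M k"
    by (rule smooth_fun_cong[OF assms(1)]) (simp add: k_def)
  then have k: "smooth_fun M k"
    using smooth_fun_const[OF assms(1)] by blast
  have g': "smooth_fun M ((-1) *\<^sub>R g)"
    using smooth_fun_scaleR[OF assms(1) g] .
  then have h: "smooth_fun M h"
    unfolding h_def by (rule smooth_fun_add[OF assms(1) True])
  have "h * k = 0 *\<^sub>R h" 
    using eq by (auto simp: h_def k_def fun_eq_iff scaleR_fun_def)
  moreover have "v (0 *\<^sub>R h) = 0"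
    using assms(2) h by (auto simp: tangent_space_def)
  moreover have "v (h * k) = h p * v k + k p * v h"
    using assms(2) h k by (auto simp: tangent_space_def)
  moreover have "h p = 0" "k p = 1"
    using assms(3) eq by (auto simp: h_def k_def scaleR_fun_def)
  ultimately have "v h = 0"
    by simp
  moreover have "v h = v f + v ((-1) *\<^sub>R g)" "v ((-1) *\<^sub>R g) = (-1) * v g"
    using assms(2) True g g' unfolding h_def tangent_space_def by blast+
  ultimately show ?thesis
    by simp
qed

lemma pushforward_tangent:
  assumes M: "smooth_manifold M" and N: "smooth_manifold N"
    and F: "smooth_map M N F" and v: "v \<in> tangent_space M p"
  shows "pushforward M N F v \<in> tangent_space N (F p)"
proof -
  have "(f + g) \<circ> F = (f \<circ> F) + (g \<circ> F)" "(f * g) \<circ> F = (f \<circ> F) * (g \<circ> F)"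
    "(r *\<^sub>R f) \<circ> F = r *\<^sub>R (f \<circ> F)" for f g :: "'c \<Rightarrow> real" and r
    by (auto simp: fun_eq_iff scaleR_fun_def)
  then show ?thesis
    using v smooth_fun_compose[OF M N F] smooth_fun_add[OF N] smooth_fun_mult[OF N]
      smooth_fun_scaleR[OF N]
    by (simp add: tangent_space_def pushforward_def)
qed

text \<open>The chain rule for \<open>G \<circ> F\<close>, which is the identity on the carrier
  only; \<open>tangent_space_pointwise\<close> covers the gap. With \<open>F\<close> a section and
  \<open>G\<close> the projection, \<open>dsec\<close> becomes a right inverse of
  \<open>dproj\<close>.\<close>

lemma pushforward_section:
  assumes M: "smooth_manifold M" and N: "smooth_manifold N"
    and F: "smooth_map M N F" and G: "smooth_map N M G"
    and v: "v \<in> tangent_space M p" "p \<in> points M"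
    and GF: "\<And>q. q \<in> points M \<Longrightarrow> G (F q) = q"
  shows "pushforward N M G (pushforward M N F v) = v"
proof
  fix g
  show "pushforward N M G (pushforward M N F v) g = v g"
  proof (cases "smooth_fun M g")
    case True
    then have "smooth_fun N (g \<circ> G)"
      using smooth_fun_compose[OF N M G] by blast
    moreover have "v (g \<circ> G \<circ> F) = v g"
      by (rule tangent_space_pointwise[OF M v]) (simp add: GF)
    ultimately show ?thesis
      using True by (simp add: pushforward_def)
  next
    case False
    then show ?thesis
      using v by (simp add: pushforward_def tangent_space_def)
  qed
qed

lemma subspace_tangent_space: "subspace (tangent_space M p)"
  by (auto simp: subspace_def tangent_space_def scaleR_fun_def algebra_simps)

lemma pushforward_linear: "linear (pushforward M N F)"
  by (rule linearI) (auto simp: pushforward_def scaleR_fun_def fun_eq_iff)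

section \<open>Linear algebra in coframes\<close>

lemma linear_on_add: "linear_on V f \<Longrightarrow> u \<in> V \<Longrightarrow> v \<in> V \<Longrightarrow> f (u + v) = f u + f v"
  by (simp add: linear_on_def)

lemma linear_on_subset: "linear_on V f \<Longrightarrow> W \<subseteq> V \<Longrightarrow> linear_on W f"
  unfolding linear_on_def by (simp add: subset_iff)

lemma linear_on_sum_scaleR:
  assumes "linear_on V f" "subspace V" "\<And>i. i \<in> I \<Longrightarrow> X i \<in> V"
  shows "f (\<Sum>i\<in>I. r i *\<^sub>R X i) = (\<Sum>i\<in>I. r i * f (X i))"
proof -
  \<comment> \<open>The value at 0 serves the empty sum and also an infinite \<open>I\<close>, where
    the sum is 0 by default.\<close>
  have "f (0 *\<^sub>R 0) = 0 * f 0"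
    using assms(1) subspace_0[OF assms(2)] unfolding linear_on_def by blast
  then have zero: "f 0 = 0"
    by simp
  show ?thesis
    using assms(3)
  proof (induction I rule: infinite_finite_induct)
    case (infinite I)
    then show ?case
      using zero by simp
  next
    case empty
    then show ?case
      using zero by simp
  next
    case (insert i I)
    have "r i *\<^sub>R X i \<in> V" "(\<Sum>j\<in>I. r j *\<^sub>R X j) \<in> V"
      using insert.prems assms(2) by (auto intro!: subspace_sum subspace_scale)
    then have "f (r i *\<^sub>R X i + (\<Sum>j\<in>I. r j *\<^sub>R X j)) = r i * f (X i) + f (\<Sum>j\<in>I. r j *\<^sub>R X j)"
      using assms(1) insert.prems by (simp add: linear_on_def)
    then show ?case
      using insert by simp
  qed
qed

lemma coframe_on_unique:
  assumes \<theta>: "coframe_on V n \<theta>" and uv: "u \<in> V" "v \<in> V"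
    and eq: "\<And>i. i \<in> {1..n} \<Longrightarrow> \<theta> i u = \<theta> i v"
  shows "u = v"
proof -
  have "\<exists>!w. w \<in> V \<and> (\<forall>i\<in>{1..n}. \<theta> i w = \<theta> i v)"
    using \<theta> unfolding coframe_on_def by (elim conjE allE[where x = "\<lambda>i. \<theta> i v"])
  then show ?thesis
    using uv eq by (elim ex1E) metis
qed

text \<open>For a coframe, an index outside \<open>{1..n}\<close> gives the vector killed by all
  coordinates, so the value lies in \<open>V\<close> for every \<open>k\<close>.\<close>

definition dual_frame :: "'v::real_vector set \<Rightarrow> nat \<Rightarrow> (nat \<Rightarrow> 'v \<Rightarrow> real) \<Rightarrow> nat \<Rightarrow> 'v" where
  "dual_frame V n \<theta> k = (THE v. v \<in> V \<and> (\<forall>i\<in>{1..n}. \<theta> i v = (if i = k then 1 else 0)))"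

lemma dual_frame:
  assumes "coframe_on V n \<theta>"
  shows "dual_frame V n \<theta> k \<in> V"
    and "i \<in> {1..n} \<Longrightarrow> \<theta> i (dual_frame V n \<theta> k) = (if i = k then 1 else 0)"
proof -
  have "\<exists>!v. v \<in> V \<and> (\<forall>i\<in>{1..n}. \<theta> i v = (if i = k then 1 else 0))"
    using assms unfolding coframe_on_def
    by (elim conjE allE[where x = "\<lambda>i. if i = k then 1 else 0"])
  note * = theI'[OF this, folded dual_frame_def]
  show "dual_frame V n \<theta> k \<in> V"
    using * by (rule conjunct1)
  show "\<theta> i (dual_frame V n \<theta> k) = (if i = k then 1 else 0)" if "i \<in> {1..n}"
    using * that by (elim conjE bspec)
qed

lemma coframe_on_combination:
  assumes "coframe_on V n \<theta>" "subspace V" "i \<in> {1..n}"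
  shows "\<theta> i (\<Sum>k=1..n. r k *\<^sub>R dual_frame V n \<theta> k) = r i"
proof -
  have "\<theta> i (\<Sum>k=1..n. r k *\<^sub>R dual_frame V n \<theta> k) =
      (\<Sum>k=1..n. r k * \<theta> i (dual_frame V n \<theta> k))"
    using assms dual_frame(1)[OF assms(1)]
    by (intro linear_on_sum_scaleR[of V]) (auto simp: coframe_on_def)
  also have "\<dots> = (\<Sum>k=1..n. if i = k then r k else 0)"
    using assms(3) dual_frame(2)[OF assms(1)] by (intro sum.cong) auto
  finally show ?thesis
    using assms(3) by simp
qed

lemma coframe_on_expansion:
  assumes "coframe_on V n \<theta>" "subspace V" "v \<in> V"
  shows "(\<Sum>k=1..n. \<theta> k v *\<^sub>R dual_frame V n \<theta> k) = v"
proof (rule coframe_on_unique[OF assms(1) _ assms(3)])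
  show "(\<Sum>k=1..n. \<theta> k v *\<^sub>R dual_frame V n \<theta> k) \<in> V"
    by (intro subspace_sum subspace_scale assms(2) dual_frame(1)[OF assms(1)])
qed (rule coframe_on_combination[OF assms(1,2)])

text \<open>Pairing with the dual basis reads off \<open>w k * \<theta> k c\<close> and so
  determines \<open>c\<close>; conversely, \<open>y\<close> is expanded in that basis. Unit weights
  make the \<open>THE\<close> in \<open>cplx_str\<close> well posed, weights \<epsilon> and 1 the
  one in \<open>chi_eps\<close>.\<close>

lemma diagonal_riesz:
  assumes \<theta>: "coframe_on V n \<theta>" and V: "subspace V" and f: "linear_on V f"
    and w: "\<And>k. k \<in> {1..n} \<Longrightarrow> w k \<noteq> 0"
  shows "c \<in> V \<and> (\<forall>y\<in>V. (\<Sum>k=1..n. w k * \<theta> k c * \<theta> k y) = f y) \<longleftrightarrow>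
    c = (\<Sum>k=1..n. (f (dual_frame V n \<theta> k) / w k) *\<^sub>R dual_frame V n \<theta> k)" (is "_ \<longleftrightarrow> c = ?s")
proof
  have s: "?s \<in> V"
    using V dual_frame(1)[OF \<theta>] by (auto intro!: subspace_sum subspace_scale)
  show "c = ?s" if c: "c \<in> V \<and> (\<forall>y\<in>V. (\<Sum>k=1..n. w k * \<theta> k c * \<theta> k y) = f y)"
  proof (rule coframe_on_unique[OF \<theta>])
    fix i assume i: "i \<in> {1..n}"
    have "f (dual_frame V n \<theta> i) = (\<Sum>k=1..n. w k * \<theta> k c * \<theta> k (dual_frame V n \<theta> i))"
      using c dual_frame(1)[OF \<theta>] by simp
    also have "\<dots> = (\<Sum>k=1..n. if i = k then w k * \<theta> k c else 0)"
      using dual_frame(2)[OF \<theta>] by (intro sum.cong) auto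
    also have "\<dots> = w i * \<theta> i c"
      using i by simp
    finally show "\<theta> i c = \<theta> i ?s"
      unfolding coframe_on_combination[OF \<theta> V i] using w[OF i] by simp
  qed (use c s in auto)
  show "c \<in> V \<and> (\<forall>y\<in>V. (\<Sum>k=1..n. w k * \<theta> k c * \<theta> k y) = f y)" if c: "c = ?s"
  proof (intro conjI ballI)
    fix y assume y: "y \<in> V"
    have "(\<Sum>k=1..n. w k * \<theta> k c * \<theta> k y) = (\<Sum>k=1..n. \<theta> k y * f (dual_frame V n \<theta> k))"
      unfolding c by (intro sum.cong) (use w in \<open>simp_all add: coframe_on_combination[OF \<theta> V] del: One_nat_def\<close>)
    also have "\<dots> = f (\<Sum>k=1..n. \<theta> k y *\<^sub>R dual_frame V n \<theta> k)"
      using dual_frame(1)[OF \<theta>] by (subst linear_on_sum_scaleR[OF f V]) auto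
    finally show "(\<Sum>k=1..n. w k * \<theta> k c * \<theta> k y) = f y"
      unfolding coframe_on_expansion[OF \<theta> V y] .
  qed (use c s in simp)
qed

lemma coframe_on_0:
  assumes "coframe_on V n \<theta>" "subspace V" "i \<in> {1..n}"
  shows "\<theta> i 0 = 0"
proof -
  have "linear_on V (\<theta> i)"
    using assms(1,3) by (simp add: coframe_on_def)
  from linear_on_sum_scaleR[OF this assms(2), of "{}" "\<lambda>_. 0" "\<lambda>_. 0"] show ?thesis
    by simp
qed

text \<open>The columns form a positively oriented orthonormal triple, so each is the cross product
  of the next two in cyclic order; the conclusion is one component of this.\<close>

lemma SO3_cofactor:
  fixes A :: "nat \<Rightarrow> nat \<Rightarrow> real"
  assumes o: "\<And>a b. a \<in> {1..3} \<Longrightarrow> b \<in> {1..3} \<Longrightarrow>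
      A 1 a * A 1 b + A 2 a * A 2 b + A 3 a * A 3 b = (if a = b then 1 else 0)"
    and d: "A 1 1 * (A 2 2 * A 3 3 - A 2 3 * A 3 2) - A 1 2 * (A 2 1 * A 3 3 - A 2 3 * A 3 1) +
      A 1 3 * (A 2 1 * A 3 2 - A 2 2 * A 3 1) > 0"
    and abc: "(a, b, c) \<in> {(1, 2, 3), (2, 3, 1), (3, 1, 2)}"
    and ijk: "(i, j, k) \<in> {(1, 2, 3), (2, 3, 1), (3, 1, 2)}"
  shows "A j b * A k c - A j c * A k b = A i a"
proof -
  \<comment> \<open>The triples \<open>(l, m, n)\<close>, \<open>(x, y, z)\<close>,
    \<open>(p, q, r)\<close> are the columns \<open>a\<close>, \<open>b\<close>, \<open>c\<close>.
    By Lagrange's identity the cross product of the last two is a unit vector. Their triple product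
    \<open>D\<close> satisfies \<open>D\<^sup>2 = 1\<close> by the Gram determinant, and positivity
    leaves \<open>D = 1\<close>. The squared distance of the cross product from the first column is
    then 1 - 2 + 1 = 0.\<close>
  have key: "y * r - q * z = l \<and> z * p - r * x = m \<and> x * q - p * y = n"
    if 1: "l * l + m * m + n * n = 1" "x * x + y * y + z * z = 1" "p * p + q * q + r * r = 1"
      "x * p + y * q + z * r = 0"
      "l * x + m * y + n * z = 0" "l * p + m * q + n * r = 0"
      and pos: "l * (y * r - q * z) + m * (z * p - r * x) + n * (x * q - p * y) > 0"
    for l m n x y z p q r :: real
  proof -
    define D where "D = l * (y * r - q * z) + m * (z * p - r * x) + n * (x * q - p * y)"
    have L: "(y * r - q * z)\<^sup>2 + (z * p - r * x)\<^sup>2 + (x * q - p * y)\<^sup>2 = 1"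
    proof -
      have "(y * r - q * z)\<^sup>2 + (z * p - r * x)\<^sup>2 + (x * q - p * y)\<^sup>2 =
          (x * x + y * y + z * z) * (p * p + q * q + r * r) - (x * p + y * q + z * r)\<^sup>2"
        by algebra
      then show ?thesis
        by (simp add: 1)
    qed
    have "D\<^sup>2 = 1"
      unfolding D_def using 1 by algebra
    then have "D = 1"
      using pos by (simp add: D_def power2_eq_1_iff)
    moreover have "(y * r - q * z - l)\<^sup>2 + (z * p - r * x - m)\<^sup>2 + (x * q - p * y - n)\<^sup>2 =
        ((y * r - q * z)\<^sup>2 + (z * p - r * x)\<^sup>2 + (x * q - p * y)\<^sup>2) - 2 * D +
        (l * l + m * m + n * n)"
      unfolding D_def by algebra
    ultimately have "(y * r - q * z - l)\<^sup>2 + (z * p - r * x - m)\<^sup>2 + (x * q - p * y - n)\<^sup>2 = 0"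
      by (simp add: L 1)
    then show ?thesis
      by (simp add: add_nonneg_eq_0_iff)
  qed
  have "A 2 b * A 3 c - A 2 c * A 3 b = A 1 a \<and> A 3 b * A 1 c - A 3 c * A 1 b = A 2 a \<and>
      A 1 b * A 2 c - A 1 c * A 2 b = A 3 a"
  proof (rule key)
    show "A 1 a * (A 2 b * A 3 c - A 2 c * A 3 b) + A 2 a * (A 3 b * A 1 c - A 3 c * A 1 b) +
        A 3 a * (A 1 b * A 2 c - A 1 c * A 2 b) > 0"
      using abc d by (auto simp: algebra_simps)
  qed (use abc o[of a a] o[of b b] o[of c c] o[of b c] o[of a b] o[of a c] in auto)
  then show ?thesis
    using ijk by (auto simp: algebra_simps)
qed

section \<open>Exterior forms\<close>

text \<open>Peels off one position at a time, so that a shuffle sum over a list of known length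
  unfolds into explicit terms.\<close>

lemma sum_Pow_insert:
  assumes "finite S" "a \<notin> S"
  shows "(\<Sum>A\<in>Pow (insert a S). f A) = (\<Sum>A\<in>Pow S. f A) + (\<Sum>A\<in>Pow S. f (insert a A))"
proof -
  have "inj_on (insert a) (Pow S)"
    using assms(2) by (auto simp: inj_on_def)
  moreover have "Pow S \<inter> insert a ` Pow S = {}"
    using assms(2) by auto
  ultimately show ?thesis
    using assms(1) by (simp add: Pow_insert sum.union_disjoint sum.reindex)
qed

text \<open>Writes the inversion count as a double sum of indicators, which simplification can
  evaluate on concrete sets of positions.\<close>

lemma shuffle_sign_eq:
  assumes "A \<subseteq> {..<n}"
  shows "shuffle_sign n A = (-1) ^ (\<Sum>i<n. \<Sum>j<i. if i \<in> A \<and> j \<notin> A then 1 else 0)"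
proof -
  have "{(i, j). i \<in> A \<and> j \<in> {..<n} - A \<and> j < i} =
      (SIGMA i:{..<n}. {j \<in> {..<i}. i \<in> A \<and> j \<notin> A})"
    using assms by auto
  then have "card {(i, j). i \<in> A \<and> j \<in> {..<n} - A \<and> j < i} =
      (\<Sum>i<n. card {j \<in> {..<i}. i \<in> A \<and> j \<notin> A})"
    by simp
  also have "\<dots> = (\<Sum>i<n. \<Sum>j<i. if i \<in> A \<and> j \<notin> A then 1 else 0)"
    by (simp add: sum.If_cases Int_def)
  finally show ?thesis
    by (simp add: shuffle_sign_def)
qed

lemma wedge_eq:
  "(\<alpha> \<and>\<^sub>f \<beta>) vs = (\<Sum>A\<in>Pow {..<length vs}.
     (-1) ^ (\<Sum>i<length vs. \<Sum>j<i. if i \<in> A \<and> j \<notin> A then 1 else 0) *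
     \<alpha> (nths vs A) * \<beta> (nths vs (- A)))"
  unfolding wedge_def by (intro sum.cong) (simp_all add: shuffle_sign_eq)

text \<open>A shuffle cuts the list into complementary sublists whose lengths add up to the total,
  so in every term some factor is evaluated in the wrong degree.\<close>

lemma wedge_support:
  assumes "\<And>vs. length vs \<noteq> p \<Longrightarrow> \<alpha> vs = 0" "\<And>vs. length vs \<noteq> q \<Longrightarrow> \<beta> vs = 0"
    and "length vs \<noteq> p + q"
  shows "(\<alpha> \<and>\<^sub>f \<beta>) vs = 0"
proof -
  have "length (nths vs A) + length (nths vs (- A)) = length vs" for A
    using card_Un_disjoint[of "{i. i < length vs \<and> i \<in> A}" "{i. i < length vs \<and> i \<in> - A}"]
    by (auto simp: length_nths Un_def Int_def)
      (metis (no_types, lifting) Collect_cong card_Collect_less_nat)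
  then have "\<alpha> (nths vs A) = 0 \<or> \<beta> (nths vs (- A)) = 0" for A
    using assms by metis
  then show ?thesis
    by (auto simp: wedge_def intro!: sum.neutral)
qed

lemma covector_support: "length vs \<noteq> 1 \<Longrightarrow> covector \<theta> vs = 0"
  by (auto simp: covector_def split: list.splits)

lemma covector_wedge_support: "length vs \<noteq> 2 \<Longrightarrow> (covector s \<and>\<^sub>f covector t) vs = 0"
  by (rule wedge_support[where \<alpha> = "covector s" and \<beta> = "covector t" and p = 1 and q = 1])
    (simp_all add: covector_support)

lemmas wedge_expand = wedge_eq sum_Pow_insert lessThan_Suc nths_Cons eval_nat_numeral

lemma wedge_1_1: "(covector s \<and>\<^sub>f covector t) [a, b] = s a * t b - s b * t a"
  by (simp add: wedge_expand covector_def)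

lemma wedge_1_2:
  assumes "\<And>vs. length vs \<noteq> 2 \<Longrightarrow> \<beta> vs = 0"
  shows "(covector s \<and>\<^sub>f \<beta>) [a, b, c] = s a * \<beta> [b, c] - s b * \<beta> [a, c] + s c * \<beta> [a, b]"
  by (simp add: wedge_expand covector_def assms)

lemma wedge_2_1:
  assumes "\<And>vs. length vs \<noteq> 2 \<Longrightarrow> \<alpha> vs = 0"
  shows "(\<alpha> \<and>\<^sub>f covector t) [a, b, c] = \<alpha> [a, b] * t c - \<alpha> [a, c] * t b + \<alpha> [b, c] * t a"
  by (simp add: wedge_expand covector_def assms)

text \<open>Of the sixteen sets of positions the support conditions leave the six two-element ones,
  with the signs of the (2,2)-shuffles.\<close>

lemma wedge_2_2:
  assumes "\<And>vs. length vs \<noteq> 2 \<Longrightarrow> \<alpha> vs = 0" "\<And>vs. length vs \<noteq> 2 \<Longrightarrow> \<beta> vs = 0"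
  shows "(\<alpha> \<and>\<^sub>f \<beta>) [a, b, c, d] =
    \<alpha> [a, b] * \<beta> [c, d] - \<alpha> [a, c] * \<beta> [b, d] + \<alpha> [a, d] * \<beta> [b, c] +
    \<alpha> [b, c] * \<beta> [a, d] - \<alpha> [b, d] * \<beta> [a, c] + \<alpha> [c, d] * \<beta> [a, b]"
  by (simp add: wedge_expand assms)

lemma alternating_on_linear:
  assumes "alternating_on V k \<alpha>" "vs \<in> lists V" "length vs = k" "i < k"
  shows "linear_on V (\<lambda>v. \<alpha> (vs[i := v]))"
  using assms by (simp add: alternating_on_def)

lemma model_omega_support: "length vs \<noteq> 2 \<Longrightarrow> model_omega dx i vs = 0"
  by (simp add: model_omega_def Let_def fun_diff_def covector_wedge_support)

lemma model_omega_eq: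
  assumes "\<And>j. j \<in> {1..4} \<Longrightarrow> dx j u = dx j u'" "\<And>j. j \<in> {1..4} \<Longrightarrow> dx j v = dx j v'"
  shows "model_omega dx i [u, v] = model_omega dx i [u', v']"
  using assms by (simp add: model_omega_def Let_def fun_diff_def wedge_1_1)

text \<open>Shuffles feeding \<open>y\<close> to a \<open>\<tau>\<close> vanish, so
  \<open>\<omega> i [u a, y]\<close> is left with a 2 by 2 minor of the matrix
  \<open>t i (u a)\<close>. That matrix lies in SO(3), hence the minor is the entry
  \<open>t i (u a)\<close> itself. In this way \<open>t\<close> and \<open>u\<close> may be any two
  frames related by a rotation, not only dual ones.\<close>

lemma model_Theta_vertical:
  assumes supp: "\<And>i vs. length vs \<noteq> 2 \<Longrightarrow> \<omega> i vs = 0"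
    and y: "\<And>i. i \<in> {1..3} \<Longrightarrow> t i y = 0"
    and o: "\<And>a b. a \<in> {1..3} \<Longrightarrow> b \<in> {1..3} \<Longrightarrow>
      (\<Sum>i=1..3. t i (u a) * t i (u b)) = (if a = b then 1 else 0)"
    and d: "(covector (t 1) \<and>\<^sub>f covector (t 2) \<and>\<^sub>f covector (t 3)) [u 1, u 2, u 3] > 0"
  defines "\<tau> \<equiv> \<lambda>i. covector (t i)"
  shows "((\<omega> 1 \<and>\<^sub>f \<tau> 2 \<and>\<^sub>f \<tau> 3) + (\<omega> 2 \<and>\<^sub>f \<tau> 3 \<and>\<^sub>f \<tau> 1) + (\<omega> 3 \<and>\<^sub>f \<tau> 1 \<and>\<^sub>f \<tau> 2))
      [u 1, u 2, u (3::nat), y] = (\<Sum>a=1..3. \<Sum>i=(1::nat)..3. \<omega> i [u a, y] * t i (u a))"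
proof -
  have t: "\<And>a b. a \<in> {1..3} \<Longrightarrow> b \<in> {1..3} \<Longrightarrow> t 1 (u a) * t 1 (u b) + t 2 (u a) * t 2 (u b) +
      t 3 (u a) * t 3 (u b) = (if a = b then 1 else 0)"
    using o by (simp add: eval_nat_numeral)
  have d': "t 1 (u 1) * (t 2 (u 2) * t 3 (u 3) - t 2 (u 3) * t 3 (u 2)) -
      t 1 (u 2) * (t 2 (u 1) * t 3 (u 3) - t 2 (u 3) * t 3 (u 1)) +
      t 1 (u 3) * (t 2 (u 1) * t 3 (u 2) - t 2 (u 2) * t 3 (u 1)) > 0"
    using d by (simp add: wedge_1_2[OF covector_wedge_support] wedge_1_1 algebra_simps)
  have cof: "t j (u b) * t k (u c) - t j (u c) * t k (u b) = t i (u a)"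
    if "(a, b, c) \<in> {(1, 2, 3), (2, 3, 1), (3, 1, 2)}"
      and "(i, j, k) \<in> {(1, 2, 3), (2, 3, 1), (3, 1, 2)}" for a b c i j k
    using SO3_cofactor[of "\<lambda>i a. t i (u a)", OF _ d' that] t by blast
  have w: "(\<omega> i \<and>\<^sub>f \<tau> j \<and>\<^sub>f \<tau> k) [u 1, u 2, u 3, y] =
      \<omega> i [u 1, y] * t i (u 1) + \<omega> i [u 2, y] * t i (u 2) + \<omega> i [u 3, y] * t i (u 3)"
    if ijk: "(i, j, k) \<in> {(1, 2, 3), (2, 3, 1), (3, 1, 2)}" for i j k
  proof -
    have "t j y = 0" "t k y = 0"
      using y ijk by auto
    then have "(\<omega> i \<and>\<^sub>f \<tau> j \<and>\<^sub>f \<tau> k) [u 1, u 2, u 3, y] =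
      \<omega> i [u 1, y] * (t j (u 2) * t k (u 3) - t j (u 3) * t k (u 2)) +
      \<omega> i [u 2, y] * (t j (u 3) * t k (u 1) - t j (u 1) * t k (u 3)) +
      \<omega> i [u 3, y] * (t j (u 1) * t k (u 2) - t j (u 2) * t k (u 1))"
      unfolding \<tau>_def by (simp add: wedge_2_2[OF supp covector_wedge_support] wedge_1_1 algebra_simps)
    then show ?thesis
      using cof[OF _ ijk, of 1 2 3] cof[OF _ ijk, of 2 3 1] cof[OF _ ijk, of 3 1 2] by simp
  qed
  show ?thesis
    using w[of 1 2 3] w[of 2 3 1] w[of 3 1 2] by (simp add: eval_nat_numeral)
qed

section \<open>Pointwise convergence of functionals\<close>

text \<open>Functions carry the product topology; this is the sense in which limits of tangent
  vectors are taken, namely by testing on each function.\<close>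

lemma tendsto_fun_iff:
  "(f \<longlongrightarrow> l) F \<longleftrightarrow> (\<forall>x. ((\<lambda>t. f t x) \<longlongrightarrow> l x) F)" for f :: "'t \<Rightarrow> 'a \<Rightarrow> 'b::topological_space"
  using limitin_componentwise[of "\<lambda>_. euclidean" UNIV f l F]
  by (simp add: euclidean_product_topology)

lemma sum_fun_apply: "(\<Sum>i\<in>I. f i) x = (\<Sum>i\<in>I. f i x)"
  by (induction I rule: infinite_finite_induct) auto

text \<open>The vectors stay fixed and only the coefficients move, as in the expansion of
  \<open>chi_section\<close> in a basis independent of \<epsilon>.\<close>

lemma tendsto_sum_scaleR_fun:
  fixes X :: "'i \<Rightarrow> 'a \<Rightarrow> real"
  assumes "\<And>i. i \<in> I \<Longrightarrow> (r i \<longlongrightarrow> l i) F"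
  shows "((\<lambda>t. \<Sum>i\<in>I. r i t *\<^sub>R X i) \<longlongrightarrow> (\<Sum>i\<in>I. l i *\<^sub>R X i)) F"
  unfolding tendsto_fun_iff sum_fun_apply scaleR_fun_def real_scaleR_def
  by (intro allI tendsto_sum tendsto_mult_right assms)

lemma tendsto_fun_unique:
  fixes f :: "'t \<Rightarrow> 'a \<Rightarrow> 'b::t2_space"
  assumes "F \<noteq> bot" "(f \<longlongrightarrow> l) F" "(f \<longlongrightarrow> l') F"
  shows "l = l'"
proof
  show "l x = l' x" for x
    using assms tendsto_unique[of F "\<lambda>t. f t x"] by (simp add: tendsto_fun_iff)
qed

section \<open>Horizontal and vertical vectors\<close>

lemma subspace_vert: "subspace (vert D x)"
  using subspace_tangent_space[of "total D" x]
  by (simp add: vert_def subspace_def linear_add[OF pushforward_linear]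
      linear_scale[OF pushforward_linear] linear_0[OF pushforward_linear])

lemma vertD: "v \<in> vert D x \<Longrightarrow> v \<in> TM D x"
  by (simp add: vert_def)

lemma bigraded_form_alternating:
  assumes "bigraded_form D p q \<alpha>" "x \<in> points (total D)"
  shows "alternating_on (TM D x) (p + q) (\<alpha> x)"
  using assms by (simp add: bigraded_form_def differential_form_def)

lemma ehresmann_connectionD:
  assumes "ehresmann_connection D" "x \<in> points (total D)"
  shows "subspace (hor D x)" "hor D x \<subseteq> TM D x" "hor D x \<inter> vert D x = {0}"
    and "v \<in> TM D x \<Longrightarrow> \<exists>h\<in>hor D x. v - h \<in> vert D x"
  using bspec[OF assms(1)[unfolded ehresmann_connection_def] assms(2)] by simp_all

text \<open>The \<open>THE\<close> in \<open>hpart\<close> is well posed: two candidates differ by a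
  vector that is both horizontal and vertical, hence zero.\<close>

lemma hor_vert_parts:
  assumes "ehresmann_connection D" "x \<in> points (total D)" "v \<in> TM D x"
  shows "hpart D x v \<in> hor D x" "vpart D x v \<in> vert D x"
proof -
  note ec = ehresmann_connectionD[OF assms(1,2)]
  have "\<exists>!h. h \<in> hor D x \<and> v - h \<in> vert D x"
  proof (rule ex_ex1I)
    show "\<exists>h. h \<in> hor D x \<and> v - h \<in> vert D x"
      using ec(4)[OF assms(3)] by blast
    fix h h' assume h: "h \<in> hor D x \<and> v - h \<in> vert D x" "h' \<in> hor D x \<and> v - h' \<in> vert D x"
    have "(v - h') - (v - h) \<in> vert D x" and "h - h' \<in> hor D x"
      using h by (blast intro: subspace_diff[OF subspace_vert] subspace_diff[OF ec(1)])+
    moreover have "(v - h') - (v - h) = h - h'"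
      by simp
    ultimately have "h - h' = 0"
      using ec(3) by fastforce
    then show "h = h'"
      by simp
  qed
  from theI'[OF this] show "hpart D x v \<in> hor D x" "vpart D x v \<in> vert D x"
    by (simp_all add: hpart_def vpart_def)
qed

lemma dproj_hpart:
  assumes "ehresmann_connection D" "x \<in> points (total D)" "v \<in> TM D x"
  shows "dproj D (hpart D x v) = dproj D v"
proof -
  have "dproj D (v - hpart D x v) = 0"
    using hor_vert_parts(2)[OF assms] by (simp add: vert_def vpart_def)
  then show ?thesis
    using linear_diff[OF pushforward_linear, of "total D" "base D" "proj D" v "hpart D x v"] by simp
qed

text \<open>The preimage \<open>v\<close> of \<open>e\<close> provides existence, through its
  horizontal part. In the application \<open>v\<close> is the image of \<open>e\<close> under the
  differential of the section.\<close>

lemma hlift: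
  assumes "ehresmann_connection D" "x \<in> points (total D)" "v \<in> TM D x" "dproj D v = e"
  shows "hlift D x e \<in> hor D x" "dproj D (hlift D x e) = e"
proof -
  note ec = ehresmann_connectionD[OF assms(1,2)]
  have "\<exists>!h. h \<in> hor D x \<and> dproj D h = e"
  proof (rule ex_ex1I)
    show "\<exists>h. h \<in> hor D x \<and> dproj D h = e"
      using hor_vert_parts(1)[OF assms(1-3)] dproj_hpart[OF assms(1-3)] assms(4) by blast
    fix h h' assume h: "h \<in> hor D x \<and> dproj D h = e" "h' \<in> hor D x \<and> dproj D h' = e"
    have hh: "h - h' \<in> hor D x"
      using h by (auto intro: subspace_diff[OF ec(1)])
    moreover have "dproj D (h - h') = 0"
      using h by (simp add: linear_diff[OF pushforward_linear])
    ultimately have "h - h' \<in> hor D x \<inter> vert D x"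
      using ec(2) by (auto simp: vert_def)
    then show "h = h'"
      using ec(3) by simp
  qed
  from theI'[OF this] show "hlift D x e \<in> hor D x" "dproj D (hlift D x e) = e"
    by (simp_all add: hlift_def)
qed

text \<open>Coordinates 1 to 4 are vertical and 5 to 7 come from the base, hence the shift by 4. In
  them \<open>g_eps\<close> is diagonal with entries \<epsilon> and 1.\<close>

definition total_coframe ::
  "('b, 'm) fibration \<Rightarrow> (nat \<Rightarrow> 'b tvec \<Rightarrow> real) \<Rightarrow> (nat \<Rightarrow> 'm tvec \<Rightarrow> real) \<Rightarrow> nat \<Rightarrow> 'm tvec \<Rightarrow> real"
where
  "total_coframe D dt dx k v = (if k \<le> 4 then dx k v else dt (k - 4) (dproj D v))"

text \<open>The base coordinates detect the projection, and the \<open>dx j\<close> detect what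
  remains once the projection vanishes. For existence, a vertical vector with prescribed
  \<open>dx\<close> and a horizontal one with prescribed \<open>dt\<close> are added; neither
  disturbs the coordinates of the other.\<close>

lemma coframe_on_total_coframe:
  assumes ec: "ehresmann_connection D" and x: "x \<in> points (total D)"
    and ad: "adapted_coframe D x dt dx"
    and into: "\<And>v. v \<in> TM D x \<Longrightarrow> dproj D v \<in> TB D (proj D x)"
    and onto: "\<And>e. e \<in> TB D (proj D x) \<Longrightarrow> \<exists>h\<in>hor D x. dproj D h = e"
  shows "coframe_on (TM D x) 7 (total_coframe D dt dx)"
proof -
  define \<theta> where "\<theta> = total_coframe D dt dx"
  have dt: "coframe_on (TB D (proj D x)) 3 dt" and dx: "coframe_on (vert D x) 4 dx"
    and lin: "\<And>j. j \<in> {1..4} \<Longrightarrow> linear_on (TM D x) (dx j)"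
    and dxh: "\<And>j h. j \<in> {1..4} \<Longrightarrow> h \<in> hor D x \<Longrightarrow> dx j h = 0"
    using ad by (auto simp: adapted_coframe_def Let_def)
  have low: "\<theta> j v = dx j v" if "j \<in> {1..4}" for j v
    using that by (simp add: \<theta>_def total_coframe_def)
  have high: "\<theta> (i + 4) v = dt i (dproj D v)" if "i \<in> {1..3}" for i v
    using that by (simp add: \<theta>_def total_coframe_def)
  have split: "k \<in> {1..4} \<or> (\<exists>i\<in>{1..3}. k = i + 4)" if k: "k \<in> {1..7}" for k :: nat
  proof (cases "k \<le> 4")
    case False
    then show ?thesis
      using k by (intro disjI2 bexI[of _ "k - 4"]) auto
  qed (use k in auto)
  have \<theta>_lin: "linear_on (TM D x) (\<theta> k)" if "k \<in> {1..7}" for k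
    using split[OF that]
  proof
    assume "k \<in> {1..4}"
    then show ?thesis
      using lin[of k] by (simp add: linear_on_def low)
  next
    assume "\<exists>i\<in>{1..3}. k = i + 4"
    then obtain i where i: "i \<in> {1..3}" "k = i + 4"
      by blast
    have "linear_on (TB D (proj D x)) (dt i)"
      using dt i(1) by (simp add: coframe_on_def)
    then show ?thesis
      using into by (simp add: i(2) linear_on_def high[OF i(1)] linear_add[OF pushforward_linear]
          linear_scale[OF pushforward_linear])
  qed
  have diff: "\<theta> k (u - v) = \<theta> k u - \<theta> k v" if "k \<in> {1..7}" "u \<in> TM D x" "v \<in> TM D x" for k u v
  proof -
    have "u - v \<in> TM D x"
      by (rule subspace_diff[OF subspace_tangent_space that(2,3)])
    then have "\<theta> k ((u - v) + v) = \<theta> k (u - v) + \<theta> k v"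
      by (rule linear_on_add[OF \<theta>_lin[OF that(1)] _ that(3)])
    then show ?thesis
      by simp
  qed
  have inj: "u = v" if uv: "u \<in> TM D x" "v \<in> TM D x" and eq: "\<And>k. k \<in> {1..7} \<Longrightarrow> \<theta> k u = \<theta> k v"
    for u v
  proof -
    have T: "u - v \<in> TM D x"
      by (rule subspace_diff[OF subspace_tangent_space uv])
    have z: "\<theta> k (u - v) = 0" if "k \<in> {1..7}" for k
      using diff[OF that uv] eq[OF that] by simp
    have "dproj D (u - v) = 0"
    proof (rule coframe_on_unique[OF dt into[OF T]])
      show "0 \<in> TB D (proj D x)"
        by (rule subspace_0[OF subspace_tangent_space])
      show "dt i (dproj D (u - v)) = dt i 0" if "i \<in> {1..3}" for i
        using z[of "i + 4"] that high[OF that] coframe_on_0[OF dt subspace_tangent_space that] by simp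
    qed
    then have V: "u - v \<in> vert D x"
      using T by (simp add: vert_def)
    have "u - v = 0"
    proof (rule coframe_on_unique[OF dx V subspace_0[OF subspace_vert]])
      show "dx j (u - v) = dx j 0" if "j \<in> {1..4}" for j
        using z[of j] that low[OF that] coframe_on_0[OF dx subspace_vert that] by simp
    qed
    then show ?thesis
      by simp
  qed
  have surj: "\<exists>v\<in>TM D x. \<forall>k\<in>{1..7}. \<theta> k v = c k" for c
  proof -
    obtain v where v: "v \<in> vert D x" "\<And>j. j \<in> {1..4} \<Longrightarrow> dx j v = c j"
      using dx unfolding coframe_on_def by blast
    have "\<exists>!e. e \<in> TB D (proj D x) \<and> (\<forall>i\<in>{1..3}. dt i e = c (i + 4))"
      using dt unfolding coframe_on_def by (elim conjE allE[where x = "\<lambda>i. c (i + 4)"])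
    then obtain e where e: "e \<in> TB D (proj D x)" "\<And>i. i \<in> {1..3} \<Longrightarrow> dt i e = c (i + 4)"
      by (elim ex1E) blast
    obtain h where h: "h \<in> hor D x" "dproj D h = e"
      using onto[OF e(1)] by blast
    have T: "v \<in> TM D x" "h \<in> TM D x"
      by (rule vertD[OF v(1)], rule subsetD[OF ehresmann_connectionD(2)[OF ec x] h(1)])
    show ?thesis
    proof (intro bexI ballI)
      fix k :: nat assume k: "k \<in> {1..7}"
      have \<theta>vh: "\<theta> k (v + h) = \<theta> k v + \<theta> k h"
        by (rule linear_on_add[OF \<theta>_lin[OF k] T])
      show "\<theta> k (v + h) = c k"
        using split[OF k]
      proof
        assume "k \<in> {1..4}"
        then show ?thesis
          using v(2) dxh[OF _ h(1)] by (simp add: \<theta>vh low)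
      next
        assume "\<exists>i\<in>{1..3}. k = i + 4"
        then obtain i where i: "i \<in> {1..3}" "k = i + 4"
          by blast
        have "dproj D v = 0"
          using v(1) by (simp add: vert_def)
        then show ?thesis
          using \<theta>vh e(2)[OF i(1)] h(2) coframe_on_0[OF dt subspace_tangent_space i(1)]
          by (simp add: i(2) high[OF i(1)])
      qed
    next
      show "v + h \<in> TM D x"
        by (rule subspace_add[OF subspace_tangent_space T])
    qed
  qed
  have "\<exists>!v. v \<in> TM D x \<and> (\<forall>k\<in>{1..7}. \<theta> k v = c k)" for c
    using surj[of c] inj by (intro ex_ex1I) (blast, metis)
  then show ?thesis
    using \<theta>_lin unfolding coframe_on_def \<theta>_def by blast
qed

section \<open>The adiabatic limit\<close>

theorem proposition2p2:
  fixes D :: "('b, 'm) fibration" and s :: "'b \<Rightarrow> 'm" and b :: 'b and e :: "nat \<Rightarrow> 'b tvec"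
  assumes "donaldson_fibration D" and "smooth_section D s"
    and "b \<in> points (base D)" and "oriented_orthonormal_basis D b e"
  shows "(\<exists>L. (chi_section D s b e \<longlongrightarrow> L) (at_right 0)) \<and>
    ((chi_section D s b e \<longlongrightarrow> 0) (at_right 0) \<longleftrightarrow>
       (\<Sum>i=1..3. cplx_str D (s b) (e i) (nabla D s b (e i))) = 0)"
proof -

  \<comment> \<open>Differentials of the section and of the projection at \<open>s b\<close>\<close>
  define x where "x = s b"
  have base: "smooth_manifold (base D)" and total: "smooth_manifold (total D)"
    and proj: "smooth_map (total D) (base D) (proj D)" and ec: "ehresmann_connection D"
    using assms(1) by (simp_all add: donaldson_fibration_def K3_bundle_def)
  have s: "smooth_map (base D) (total D) s" and ps: "\<And>q. q \<in> points (base D) \<Longrightarrow> proj D (s q) = q"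
    using assms(2) by (simp_all add: smooth_section_def)
  have x: "x \<in> points (total D)"
    using s assms(3) by (auto simp: smooth_map_def continuous_map_def x_def)
  have px: "proj D x = b"
    by (simp add: x_def ps assms(3))
  have e: "e a \<in> TB D b" if "a \<in> {1..3}" for a
    using assms(4) that by (simp add: oriented_orthonormal_basis_def)
  have ds: "dsec D s w \<in> TM D x" if "w \<in> TB D b" for w
    unfolding x_def by (rule pushforward_tangent[OF base total s that])
  have dds: "dproj D (dsec D s w) = w" if "w \<in> TB D b" for w
    by (rule pushforward_section[OF base total s proj that assms(3) ps])
  have into: "dproj D v \<in> TB D b" if "v \<in> TM D x" for v
    using pushforward_tangent[OF total base proj that] by (simp add: px)
  \<comment> \<open>The section itself supplies surjectivity: \<open>dsec D s w\<close> projects to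
    \<open>w\<close>, and so does its horizontal part.\<close>
  have onto: "\<exists>h\<in>hor D x. dproj D h = w" if "w \<in> TB D b" for w
    using hlift[OF ec x ds[OF that] dds[OF that]] by blast

  \<comment> \<open>The adapted coframe and the model forms\<close>
  obtain dt dx where ad: "adapted_coframe D x dt dx"
    using assms(1) x by (auto simp: donaldson_fibration_def)
  define \<theta> where "\<theta> = total_coframe D dt dx"
  have \<theta>: "coframe_on (TM D x) 7 \<theta>"
    unfolding \<theta>_def using coframe_on_total_coframe[OF ec x ad] into onto px by simp
  have dt: "coframe_on (TB D b) 3 dt" and dx: "coframe_on (vert D x) 4 dx"
    and dxlin: "\<And>j. j \<in> {1..4} \<Longrightarrow> linear_on (TM D x) (dx j)"
    and dxh: "\<And>j h. j \<in> {1..4} \<Longrightarrow> h \<in> hor D x \<Longrightarrow> dx j h = 0"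
    and ori: "\<And>us. us \<in> lists (TB D b) \<Longrightarrow>
      (covector (dt 1) \<and>\<^sub>f covector (dt 2) \<and>\<^sub>f covector (dt 3)) us > 0 \<longleftrightarrow> orient D b us > 0"
    and bm: "\<And>u v. u \<in> TB D b \<Longrightarrow> v \<in> TB D b \<Longrightarrow>
      base_metric D b u v = (\<Sum>i=1..3. dt i u * dt i v)"
    and fm: "\<And>u v. u \<in> TM D x \<Longrightarrow> v \<in> TM D x \<Longrightarrow>
      fibre_metric D x u v = (\<Sum>j=1..4. dx j u * dx j v)"
    using ad by (simp_all add: adapted_coframe_def Let_def px)
  define t where "t i v = dt i (dproj D v)" for i v
  define \<tau> where "\<tau> i = covector (t i)" for i
  define \<omega> where "\<omega> = model_omega dx"
  have om: "omega D x vs = ((\<omega> 1 \<and>\<^sub>f \<tau> 1) + (\<omega> 2 \<and>\<^sub>f \<tau> 2) + (\<omega> 3 \<and>\<^sub>f \<tau> 3)) vs"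
    and Th: "Theta D x vs = - ((\<omega> 1 \<and>\<^sub>f \<tau> 2 \<and>\<^sub>f \<tau> 3) + (\<omega> 2 \<and>\<^sub>f \<tau> 3 \<and>\<^sub>f \<tau> 1)
                              + (\<omega> 3 \<and>\<^sub>f \<tau> 1 \<and>\<^sub>f \<tau> 2)) vs"
    if "vs \<in> lists (TM D x)" for vs
    using ad that by (simp_all add: adapted_coframe_def Let_def px t_def[abs_def] \<tau>_def \<omega>_def)
  have omega_support: "\<omega> i vs = 0" if "length vs \<noteq> 2" for i vs
    unfolding \<omega>_def using that by (rule model_omega_support)
  have t0: "t i v = 0" if "i \<in> {1..3}" "v \<in> vert D x" for i v
    using coframe_on_0[OF dt subspace_tangent_space that(1)] that(2) by (simp add: t_def vert_def)

  \<comment> \<open>Evaluation of \<open>omega\<close> and \<open>Theta\<close> on the derivatives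
    of the section\<close>
  define u where "u a = dsec D s (e a)" for a
  define v where "v a = nabla D s b (e a)" for a
  have u: "u a \<in> TM D x" "dproj D (u a) = e a" if "a \<in> {1..3}" for a
    using ds dds e[OF that] by (simp_all add: u_def)
  have v: "v a \<in> vert D x" if "a \<in> {1..3}" for a
    using hor_vert_parts(2)[OF ec x u(1)[OF that]] by (simp add: v_def u_def nabla_def x_def)
  \<comment> \<open>Since the \<open>dx j\<close> vanish on \<open>H\<close>, a derivative and its
    vertical part are interchangeable inside every \<open>\<omega> i\<close>.\<close>
  have dxu: "dx j (u a) = dx j (v a)" if "j \<in> {1..4}" "a \<in> {1..3}" for j a
  proof -
    have h: "hpart D x (u a) \<in> hor D x"
      using hor_vert_parts(1)[OF ec x u(1)[OF that(2)]] .
    have "u a = v a + hpart D x (u a)"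
      by (simp add: v_def u_def nabla_def vpart_def x_def)
    moreover have "dx j (v a + hpart D x (u a)) = dx j (v a) + dx j (hpart D x (u a))"
      by (rule linear_on_add[OF dxlin[OF that(1)] vertD[OF v[OF that(2)]]
            subsetD[OF ehresmann_connectionD(2)[OF ec x] h]])
    ultimately show ?thesis
      using dxh[OF that(1) h] by simp
  qed

  have omega_comp: "omega_comp D x (e a) (v a) y = (\<Sum>i=1..3. \<omega> i [u a, y] * t i (u a))"
    if a: "a \<in> {1..3}" and y: "y \<in> vert D x" for a y
  proof -
    define h where "h = hlift D x (e a)"
    have h: "h \<in> hor D x" "dproj D h = e a"
      using hlift[OF ec x u[OF a]] by (simp_all add: h_def)
    have l: "[v a, y, h] \<in> lists (TM D x)"
      using vertD[OF v[OF a]] vertD[OF y] subsetD[OF ehresmann_connectionD(2)[OF ec x] h(1)]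
      by simp
    have "\<omega> i [v a, y] = \<omega> i [u a, y]" for i
      unfolding \<omega>_def by (rule model_omega_eq) (use dxu[OF _ a] in simp_all)
    moreover have "t i h = t i (u a)" for i
      by (simp add: t_def h(2) u(2)[OF a])
    \<comment> \<open>\<open>\<tau> i\<close> kills both vertical arguments; only the term that
      feeds it \<open>h\<close> survives, with sign plus.\<close>
    moreover have "(\<omega> i \<and>\<^sub>f \<tau> i) [v a, y, h] = \<omega> i [v a, y] * t i h" if "i \<in> {1..3}" for i
      using t0[OF that v[OF a]] t0[OF that y]
      by (simp add: \<tau>_def wedge_2_1[OF omega_support])
    ultimately show ?thesis
      by (simp add: omega_comp_def h_def[symmetric] om[OF l] eval_nat_numeral)
  qed

  have Theta: "Theta D x [u 1, u 2, u 3, y] = - (\<Sum>a=1..3. omega_comp D x (e a) (v a) y)"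
    if y: "y \<in> vert D x" for y
  proof -
    have l: "[u 1, u 2, u 3, y] \<in> lists (TM D x)"
      using u(1) vertD[OF y] by simp
    \<comment> \<open>\<open>dt\<close> and \<open>e\<close> are both orthonormal for
      \<open>base_metric\<close>, so their pairing matrix is orthogonal; agreement of the
      orientations then makes its determinant positive.\<close>
    have on: "(\<Sum>i=1..3. t i (u a) * t i (u c)) = (if a = c then 1 else 0)"
      if "a \<in> {1..3}" "c \<in> {1..3}" for a c
      using bm[OF e[OF that(1)] e[OF that(2)]] assms(4) that u(2)
      by (simp add: t_def oriented_orthonormal_basis_def)
    have "(covector (dt 1) \<and>\<^sub>f covector (dt 2) \<and>\<^sub>f covector (dt 3)) [e 1, e 2, e 3] > 0"
      using ori[of "[e 1, e 2, e 3]"] e assms(4) by (simp add: oriented_orthonormal_basis_def)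
    then have "(covector (t 1) \<and>\<^sub>f covector (t 2) \<and>\<^sub>f covector (t 3)) [u 1, u 2, u 3] > 0"
      by (simp add: wedge_1_2[OF covector_wedge_support] wedge_1_1 t_def u(2))
    note model_Theta_vertical[OF omega_support t0[OF _ y] on this]
    also have "(\<Sum>a=1..3. \<Sum>i=1..3. \<omega> i [u a, y] * t i (u a)) =
        (\<Sum>a=1..3. omega_comp D x (e a) (v a) y)"
      by (intro sum.cong refl omega_comp[symmetric] y)
    finally show ?thesis
      unfolding Th[OF l] \<tau>_def by simp
  qed

  \<comment> \<open>The complex structures and the Fueter sum \<open>S\<close>\<close>
  define I where "I a = cplx_str D x (e a) (v a)" for a
  have I: "I a \<in> vert D x \<and> (\<forall>y\<in>vert D x. (\<Sum>j=1..4. dx j (I a) * dx j y) =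
      omega_comp D x (e a) (v a) y)" if a: "a \<in> {1..3}" for a
  proof -
    define f where "f = omega_comp D x (e a) (v a)"
    have "bigraded_form D 1 2 (omega D)"
      using assms(1) by (simp add: donaldson_fibration_def)
    then have alt: "alternating_on (TM D x) (1 + 2) (omega D x)"
      using x by (rule bigraded_form_alternating)
    have l: "[v a, 0, hlift D x (e a)] \<in> lists (TM D x)"
      using vertD[OF v[OF a]] subspace_0[OF subspace_tangent_space]
        subsetD[OF ehresmann_connectionD(2)[OF ec x] hlift(1)[OF ec x u[OF a]]] by simp
    \<comment> \<open>The 0 is a placeholder for the slot that \<open>w\<close> overwrites.\<close>
    have "linear_on (TM D x) (\<lambda>w. omega D x ([v a, 0, hlift D x (e a)][1 := w]))"
      by (rule alternating_on_linear[OF alt l]) simp_all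
    then have f: "linear_on (vert D x) f"
      using linear_on_subset[OF _ subsetI[OF vertD]]
      by (simp add: f_def omega_comp_def[abs_def])
    note riesz = diagonal_riesz[OF dx subspace_vert f, of "\<lambda>_. 1", simplified]
    have "(w \<in> vert D x \<and> (\<forall>y\<in>vert D x. f y = fibre_metric D x w y)) \<longleftrightarrow>
        (w \<in> vert D x \<and> (\<forall>y\<in>vert D x. (\<Sum>j=1..4. dx j w * dx j y) = f y))" for w
      using fm[OF vertD vertD] by auto
    then have "I a = (THE w. w \<in> vert D x \<and> (\<forall>y\<in>vert D x. (\<Sum>j=1..4. dx j w * dx j y) = f y))"
      by (simp add: I_def cplx_str_def f_def)
    then show ?thesis
      using riesz by (simp add: f_def[symmetric])
  qed
  define S where "S = (\<Sum>a=1..3. I a)"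
  have S: "S \<in> vert D x"
    unfolding S_def using I by (intro subspace_sum subspace_vert) auto
  have ThS: "Theta D x [u 1, u 2, u 3, y] = - (\<Sum>j=1..4. dx j S * dx j y)" if y: "y \<in> vert D x" for y
  proof -
    have "dx j S = (\<Sum>a=1..3. dx j (I a))" if "j \<in> {1..4}" for j
      using linear_on_sum_scaleR[OF dxlin[OF that] subspace_tangent_space, of "{1..3}" I "\<lambda>_. 1",
          OF vertD[OF conjunct1[OF I]]] by (simp add: S_def)
    then have "(\<Sum>j=1..4. dx j S * dx j y) = (\<Sum>j=1..4. \<Sum>a=1..3. dx j (I a) * dx j y)"
      by (simp add: sum_distrib_right)
    also have "\<dots> = (\<Sum>a=1..3. \<Sum>j=1..4. dx j (I a) * dx j y)"
      by (rule sum.swap)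
    also have "\<dots> = (\<Sum>a=1..3. omega_comp D x (e a) (v a) y)"
      using I y by (intro sum.cong) auto
    finally show ?thesis
      unfolding Theta[OF y] by simp
  qed

  \<comment> \<open>Raising the index with the rescaled metric\<close>
  define X where "X = dual_frame (TM D x) 7 \<theta>"
  define T where "T y = Theta D x [u 1, u 2, u 3, y]" for y
  define m where "m y = mu D x [u 1, u 2, u 3, y]" for y
  define w where "w \<epsilon> k = (if k \<le> 4 then \<epsilon> else 1)" for \<epsilon> :: real and k :: nat
  have four: "linear_on (TM D x) (\<lambda>y. \<alpha> [u 1, u 2, u 3, y])" if "alternating_on (TM D x) 4 \<alpha>" for \<alpha>
  proof -
    have l: "[u 1, u 2, u 3, 0] \<in> lists (TM D x)"
      using u(1) subspace_0[OF subspace_tangent_space] by auto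
    then have "linear_on (TM D x) (\<lambda>y. \<alpha> ([u 1, u 2, u 3, 0][3 := y]))"
      by (intro alternating_on_linear[OF that]) simp_all
    then show ?thesis
      by (simp add: eval_nat_numeral)
  qed
  have "bigraded_form D 2 2 (Theta D)" "bigraded_form D 0 4 (mu D)"
    using assms(1) by (simp_all add: donaldson_fibration_def)
  then have "alternating_on (TM D x) 4 (Theta D x)" "alternating_on (TM D x) 4 (mu D x)"
    using bigraded_form_alternating[OF _ x] by fastforce+
  then have "linear_on (TM D x) T" "linear_on (TM D x) m"
    unfolding T_def m_def by (auto intro: four simp del: One_nat_def)
  then have lin: "linear_on (TM D x) (\<lambda>y. \<epsilon> * T y + \<epsilon>\<^sup>2 * m y)" for \<epsilon>
    by (simp add: linear_on_def algebra_simps)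
  \<comment> \<open>For positive \<epsilon> the weights are nonzero, so each coefficient is the
    4-form evaluated on a dual basis vector, divided by the weight of that vector.\<close>
  have chi: "chi_section D s b e \<epsilon> = (\<Sum>k=1..7. ((\<epsilon> * T (X k) + \<epsilon>\<^sup>2 * m (X k)) / w \<epsilon> k) *\<^sub>R X k)"
    if "\<epsilon> > 0" for \<epsilon>
  proof -
    have g: "g_eps D \<epsilon> x c y = (\<Sum>k=1..7. w \<epsilon> k * \<theta> k c * \<theta> k y)"
      if "c \<in> TM D x" "y \<in> TM D x" for c y
      unfolding g_eps_def px fm[OF that] bm[OF into[OF that(1)] into[OF that(2)]]
      by (simp add: eval_nat_numeral w_def \<theta>_def total_coframe_def algebra_simps)
    have "w \<epsilon> k \<noteq> 0" for k
      using that by (simp add: w_def)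
    note riesz = diagonal_riesz[OF \<theta> subspace_tangent_space lin, of "w \<epsilon>" _ \<epsilon>, OF this]
    have "chi_section D s b e \<epsilon> = (THE c. c \<in> TM D x \<and> (\<forall>y\<in>TM D x. g_eps D \<epsilon> x c y = \<epsilon> * T y + \<epsilon>\<^sup>2 * m y))"
      by (simp add: chi_section_def chi_eps_def u_def[symmetric] x_def[symmetric] star_phi_def
          scaleR_fun_def T_def m_def)
    also have "\<dots> = (THE c. c \<in> TM D x \<and>
        (\<forall>y\<in>TM D x. (\<Sum>k=1..7. w \<epsilon> k * \<theta> k c * \<theta> k y) = \<epsilon> * T y + \<epsilon>\<^sup>2 * m y))"
      using g by (intro arg_cong[where f = The] ext) (auto cong: conj_cong)
    finally show ?thesis
      unfolding riesz X_def[symmetric] by simp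
  qed
  have X: "X k \<in> TM D x" for k
    unfolding X_def by (rule dual_frame(1)[OF \<theta>])
  \<comment> \<open>The formula \<open>ThS\<close> holds on vertical vectors; the first four dual
    vectors qualify because their base coordinates vanish.\<close>
  have Xv: "X k \<in> vert D x" if "k \<in> {1..4}" for k
  proof -
    have "dproj D (X k) = 0"
    proof (rule coframe_on_unique[OF dt into[OF X] subspace_0[OF subspace_tangent_space]])
      fix i :: nat assume i: "i \<in> {1..3}"
      then have "\<theta> (i + 4) (X k) = 0"
        using dual_frame(2)[OF \<theta>, of "i + 4" k] that by (auto simp: X_def)
      then show "dt i (dproj D (X k)) = dt i 0"
        using i coframe_on_0[OF dt subspace_tangent_space i] by (simp add: \<theta>_def total_coframe_def)
    qed
    then show ?thesis
      using X by (simp add: vert_def)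
  qed
  have lim: "((\<lambda>\<epsilon>. (\<epsilon> * T (X k) + \<epsilon>\<^sup>2 * m (X k)) / w \<epsilon> k) \<longlongrightarrow> - \<theta> k S) (at_right 0)"
    if k: "k \<in> {1..7}" for k
  proof (cases "k \<le> 4")
    case True
    then have k4: "k \<in> {1..4}"
      using k by simp
    have "T (X k) = - (\<Sum>j=1..4. dx j S * dx j (X k))"
      unfolding T_def by (rule ThS[OF Xv[OF k4]])
    also have "(\<Sum>j=1..4. dx j S * dx j (X k)) = (\<Sum>j=1..4. if j = k then dx j S else 0)"
    proof (rule sum.cong)
      fix j :: nat assume j: "j \<in> {1..4}"
      then have "dx j (X k) = \<theta> j (X k)"
        by (simp add: \<theta>_def total_coframe_def)
      also have "\<dots> = (if j = k then 1 else 0)"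
        unfolding X_def using j by (intro dual_frame(2)[OF \<theta>]) simp
      finally show "dx j S * dx j (X k) = (if j = k then dx j S else 0)"
        by simp
    qed simp
    also have "\<dots> = \<theta> k S"
      using k4 by (simp add: \<theta>_def total_coframe_def)
    finally have "T (X k) = - \<theta> k S" .
    moreover have "((\<lambda>\<epsilon>. T (X k) + \<epsilon> * m (X k)) \<longlongrightarrow> T (X k) + 0 * m (X k)) (at_right 0)"
      by (intro tendsto_intros)
    \<comment> \<open>Division by the weight cancels one \<epsilon> and leaves \<open>mu\<close> at
      order \<epsilon>. The identity holds for \<epsilon> positive, that is, eventually in
      \<open>at_right 0\<close>.\<close>
    moreover have "\<forall>\<^sub>F \<epsilon> in at_right 0. T (X k) + \<epsilon> * m (X k) =
        (\<epsilon> * T (X k) + \<epsilon>\<^sup>2 * m (X k)) / w \<epsilon> k"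
      using eventually_at_right_less[of 0]
      by eventually_elim (use True in \<open>simp add: w_def field_simps power2_eq_square\<close>)
    ultimately show ?thesis
      using Lim_transform_eventually by fastforce
  next
    case False
    \<comment> \<open>\<open>S\<close> is vertical, so its base coordinates are 0. The weight is 1
      here, and both terms of the coefficient tend to 0 as well.\<close>
    then have "\<theta> k S = t (k - 4) S"
      by (simp add: \<theta>_def total_coframe_def t_def)
    also have "\<dots> = 0"
      using k False by (intro t0 S) auto
    finally have "\<theta> k S = 0" .
    moreover have "((\<lambda>\<epsilon>. \<epsilon> * T (X k) + \<epsilon>\<^sup>2 * m (X k)) \<longlongrightarrow> 0 * T (X k) + 0\<^sup>2 * m (X k)) (at_right 0)"
      by (intro tendsto_intros)
    ultimately show ?thesis
      using False by (simp add: w_def)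
  qed

  \<comment> \<open>The limit and the equivalence\<close>
  have "((\<lambda>\<epsilon>. \<Sum>k=1..7. ((\<epsilon> * T (X k) + \<epsilon>\<^sup>2 * m (X k)) / w \<epsilon> k) *\<^sub>R X k)
      \<longlongrightarrow> (\<Sum>k=1..7. (- \<theta> k S) *\<^sub>R X k)) (at_right 0)"
    by (rule tendsto_sum_scaleR_fun[OF lim])
  moreover have "(\<Sum>k=1..7. (- \<theta> k S) *\<^sub>R X k) = - S"
    using coframe_on_expansion[OF \<theta> subspace_tangent_space vertD[OF S]]
    by (simp add: X_def sum_negf)
  moreover have "\<forall>\<^sub>F \<epsilon> in at_right 0.
      (\<Sum>k=1..7. ((\<epsilon> * T (X k) + \<epsilon>\<^sup>2 * m (X k)) / w \<epsilon> k) *\<^sub>R X k) = chi_section D s b e \<epsilon>"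
    using eventually_at_right_less[of 0] by eventually_elim (simp add: chi)
  ultimately have L: "(chi_section D s b e \<longlongrightarrow> - S) (at_right 0)"
    using Lim_transform_eventually by fastforce
  have S_eq: "S = (\<Sum>i=1..3. cplx_str D (s b) (e i) (nabla D s b (e i)))"
    by (simp add: S_def I_def v_def x_def)
  \<comment> \<open>Convergence to \<open>- S\<close> is unconditional and gives the existence
    claim; uniqueness of limits turns a zero limit into \<open>S = 0\<close>.\<close>
  have "(chi_section D s b e \<longlongrightarrow> 0) (at_right 0) \<longleftrightarrow> S = 0"
  proof
    assume "(chi_section D s b e \<longlongrightarrow> 0) (at_right 0)"
    then have "0 = - S"
      using L by (rule tendsto_fun_unique[OF trivial_limit_at_right_real])
    then show "S = 0"
      by simp
  qed (use L in simp)
  then show ?thesis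
    using L unfolding S_eq by blast
qed

end
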